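(* Let $n\ge1$ and let $\mathcal D$ be the set of $(A,v,w)\in\mathbb R^{n\times n}\times\mathbb R^n\times\mathbb R^n$ with $\delta_P\delta_Q\delta_R\ne0$. For $(A,v,w)\in\mathcal D$ let $P,Q,R$ be the unique solutions of $P=APA^\top+vv^\top$, $Q=A_2^\top QA_2+ww^\top$, $R=ARA_2+vw^\top$, where $A_2=A+vw^\top$. Consider the "cleared equation" (an identity in the indeterminate $\lambda$) $$\det(I+PQ)\,\det\bigl(\det(Q)\lambda P-R\operatorname{adj}(Q)R^\top\bigr)=\det(P)\det(Q)^n\det\bigl((\lambda-1)I+\lambda PQ\bigr)\qquad(\ast)$$ and its polynomial form $$\det\widehat N\,\det\bigl(\delta_R^{2}\det(\widehat Q)\lambda\widehat P-\delta_P\delta_Q\widehat R\operatorname{adj}(\widehat Q)\widehat R^\top\bigr)=\delta_R^{2n}\det\widehat P\,\det(\widehat Q)^n\det\bigl((\lambda-1)\delta_P\delta_QI+\lambda\widehat P\widehat Q\bigr).\qquad(\ast\ast)$$ (i) At any $(A,v,w)\in\mathcal D$ with $P,Q,I+PQ$ nonsingular, $(\ast)$ is equivalent to $$\det(\lambda I-P^{-1}RQ^{-1}R^\top)=\det(\lambda I-(I+PQ)^{-1}),$$ and hence to $\sigma(P^{-1}RQ^{-1}R^\top)=\sigma((I+PQ)^{-1})$. (ii) Expand the difference of the two sides of $(\ast\ast)$ in powers of $\lambda$; its coefficients are finitely many polynomials $\widehat c_k\in\mathbb R[A,v,w]$ in the entries of $(A,v,w)$. Every $\widehat c_k$ vanishes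 identically; consequently $(\ast)$ holds throughout $\mathcal D$. (iii) Consequently, at every $(A,v,w)\in\mathcal D$ with $P,Q,I+PQ$ nonsingular, $\sigma(P^{-1}RQ^{-1}R^\top)=\sigma((I+PQ)^{-1})$.
   Context: $\sigma(M)$ is the multiset of complex eigenvalues of $M$ with algebraic multiplicity; $\operatorname{adj}$ is the adjugate. With $A_2=A+vw^\top$, $$\delta_P=\det(I-A\otimes A),\quad \delta_Q=\det(I-A_2^\top\otimes A_2^\top),\quad \delta_R=\det(I-A_2^\top\otimes A).$$ These are nonzero exactly when no product of two eigenvalues drawn from $\sigma(A)\cup\sigma(A_2)$ (self-pairs and repeats included) equals $1$. The numerator matrices are $\widehat P=\delta_PP$, $\widehat Q=\delta_QQ$, $\widehat R=\delta_RR$, which are polynomial in the entries of $(A,v,w)$ and hence defined on the entire parameter space, explicitly by (column-stacking vectorization) $$\operatorname{vec}(\widehat P)=\operatorname{adj}(I-A\otimes A)\operatorname{vec}(vv^\top),\quad \operatorname{vec}(\widehat Q)=\operatorname{adj}(I-A_2^\top\otimes A_2^\top)\operatorname{vec}(ww^\top),\quad \operatorname{vec}(\widehat R)=\operatorname{adj}(I-A_2^\top\otimes A)\operatorname{vec}(vw^\top).$$ Finally $\widehat N=\delta_P\delta_QI+\widehat P\widehat Q$. *)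

theory Defs
  imports
    "Jordan_Normal_Form.Char_Poly"
    "Jordan_Normal_Form.Gauss_Jordan_Elimination"
    "HOL-Library.Poly_Mapping"
begin

definition outer :: "'a :: comm_ring_1 vec \<Rightarrow> 'a vec \<Rightarrow> 'a mat" where
  "outer v w = mat (dim_vec v) (dim_vec w) (\<lambda>(i, j). v $ i * w $ j)"

definition kron :: "'a :: comm_ring_1 mat \<Rightarrow> 'a mat \<Rightarrow> 'a mat" where
  "kron A B = mat (dim_row A * dim_row B) (dim_col A * dim_col B)
     (\<lambda>(i, j). A $$ (i div dim_row B, j div dim_col B) * B $$ (i mod dim_row B, j mod dim_col B))"

text \<open>Column-stacking vectorization, and its inverse on square matrices of size \<open>n\<close>.\<close>

definition vec_of_mat :: "'a mat \<Rightarrow> 'a vec" where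
  "vec_of_mat X = vec (dim_row X * dim_col X) (\<lambda>k. X $$ (k mod dim_row X, k div dim_row X))"

definition mat_of_vec :: "nat \<Rightarrow> 'a vec \<Rightarrow> 'a mat" where
  "mat_of_vec n x = mat n n (\<lambda>(i, j). x $ (j * n + i))"

lemma mat_of_vec_of_mat:
  assumes "X \<in> carrier_mat n n"
  shows "mat_of_vec n (vec_of_mat X) = X"
proof (rule eq_matI)
  fix i j assume "i < dim_row X" "j < dim_col X"
  with assms have ij: "i < n" "j < n" by auto
  have "j * n + i < (j + 1) * n" using ij by simp
  also have "\<dots> \<le> n * n" using ij by (intro mult_right_mono) auto
  finally show "mat_of_vec n (vec_of_mat X) $$ (i, j) = X $$ (i, j)"
    using ij assms by (auto simp: mat_of_vec_def vec_of_mat_def)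
qed (use assms in \<open>auto simp: mat_of_vec_def\<close>)

lemma vec_of_mat_of_vec:
  assumes "x \<in> carrier_vec (n * n)"
  shows "vec_of_mat (mat_of_vec n x) = x"
proof (rule eq_vecI)
  fix k assume "k < dim_vec x"
  with assms have k: "k < n * n" by auto
  then have "0 < n" by (cases n) auto
  with k have "k mod n < n" "k div n < n" by (auto simp: less_mult_imp_div_less)
  then show "vec_of_mat (mat_of_vec n x) $ k = x $ k"
    using k by (auto simp: mat_of_vec_def vec_of_mat_def)
qed (use assms in \<open>auto simp: mat_of_vec_def vec_of_mat_def\<close>)

text \<open>The determinants and numerator matrices are defined over an arbitrary commutative ring,
  so that they can be taken both at real parameters and at matrices of indeterminates.\<close>

definition A2 :: "'a :: comm_ring_1 mat \<Rightarrow> 'a vec \<Rightarrow> 'a vec \<Rightarrow> 'a mat" where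
  "A2 A v w = A + outer v w"

definition I_minus_kron :: "'a :: comm_ring_1 mat \<Rightarrow> 'a mat \<Rightarrow> 'a mat" where
  "I_minus_kron F G = 1\<^sub>m (dim_row F * dim_row G) - kron F G"

definition delta_P :: "'a :: comm_ring_1 mat \<Rightarrow> 'a" where
  "delta_P A = det (I_minus_kron A A)"

definition delta_Q :: "'a :: comm_ring_1 mat \<Rightarrow> 'a vec \<Rightarrow> 'a vec \<Rightarrow> 'a" where
  "delta_Q A v w = det (I_minus_kron (transpose_mat (A2 A v w)) (transpose_mat (A2 A v w)))"

definition delta_R :: "'a :: comm_ring_1 mat \<Rightarrow> 'a vec \<Rightarrow> 'a vec \<Rightarrow> 'a" where
  "delta_R A v w = det (I_minus_kron (transpose_mat (A2 A v w)) A)"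

definition P_hat :: "'a :: comm_ring_1 mat \<Rightarrow> 'a vec \<Rightarrow> 'a mat" where
  "P_hat A v = mat_of_vec (dim_row A)
     (adj_mat (I_minus_kron A A) *\<^sub>v vec_of_mat (outer v v))"

definition Q_hat :: "'a :: comm_ring_1 mat \<Rightarrow> 'a vec \<Rightarrow> 'a vec \<Rightarrow> 'a mat" where
  "Q_hat A v w = mat_of_vec (dim_row A)
     (adj_mat (I_minus_kron (transpose_mat (A2 A v w)) (transpose_mat (A2 A v w)))
        *\<^sub>v vec_of_mat (outer w w))"

definition R_hat :: "'a :: comm_ring_1 mat \<Rightarrow> 'a vec \<Rightarrow> 'a vec \<Rightarrow> 'a mat" where
  "R_hat A v w = mat_of_vec (dim_row A)
     (adj_mat (I_minus_kron (transpose_mat (A2 A v w)) A) *\<^sub>v vec_of_mat (outer v w))"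

definition N_hat :: "'a :: comm_ring_1 mat \<Rightarrow> 'a vec \<Rightarrow> 'a vec \<Rightarrow> 'a mat" where
  "N_hat A v w = (delta_P A * delta_Q A v w) \<cdot>\<^sub>m 1\<^sub>m (dim_row A) + P_hat A v * Q_hat A v w"

definition param_domain :: "nat \<Rightarrow> (real mat \<times> real vec \<times> real vec) set" where
  "param_domain n = {(A, v, w). A \<in> carrier_mat n n \<and> v \<in> carrier_vec n \<and> w \<in> carrier_vec n \<and>
     delta_P A * delta_Q A v w * delta_R A v w \<noteq> 0}"

definition solves_P :: "real mat \<Rightarrow> real vec \<Rightarrow> real mat \<Rightarrow> bool" where
  "solves_P A v X \<longleftrightarrow> X \<in> carrier_mat (dim_row A) (dim_row A) \<and>
     X = A * X * transpose_mat A + outer v v"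

definition solves_Q :: "real mat \<Rightarrow> real vec \<Rightarrow> real vec \<Rightarrow> real mat \<Rightarrow> bool" where
  "solves_Q A v w X \<longleftrightarrow> X \<in> carrier_mat (dim_row A) (dim_row A) \<and>
     X = transpose_mat (A2 A v w) * X * A2 A v w + outer w w"

definition solves_R :: "real mat \<Rightarrow> real vec \<Rightarrow> real vec \<Rightarrow> real mat \<Rightarrow> bool" where
  "solves_R A v w X \<longleftrightarrow> X \<in> carrier_mat (dim_row A) (dim_row A) \<and>
     X = A * X * A2 A v w + outer v w"

definition sol_P :: "real mat \<Rightarrow> real vec \<Rightarrow> real mat" where
  "sol_P A v = (THE X. solves_P A v X)"

definition sol_Q :: "real mat \<Rightarrow> real vec \<Rightarrow> real vec \<Rightarrow> real mat" where
  "sol_Q A v w = (THE X. solves_Q A v w X)"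

definition sol_R :: "real mat \<Rightarrow> real vec \<Rightarrow> real vec \<Rightarrow> real mat" where
  "sol_R A v w = (THE X. solves_R A v w X)"

text \<open>Both equations are identities of polynomials in \<open>\<lambda>\<close>: the indeterminate is \<open>[:0, 1:]\<close>, and
  matrices over the coefficient ring are embedded entrywise as constant polynomials.\<close>

abbreviation lam :: "'a :: comm_ring_1 poly" where
  "lam \<equiv> [:0, 1:]"

definition const_mat :: "'a :: comm_ring_1 mat \<Rightarrow> 'a poly mat" where
  "const_mat M = map_mat (\<lambda>a. [:a:]) M"

definition cleared_eq :: "real mat \<Rightarrow> real mat \<Rightarrow> real mat \<Rightarrow> bool" where
  "cleared_eq P Q R \<longleftrightarrow> (let n = dim_row P in
     [:det (1\<^sub>m n + P * Q):] *
       det (([:det Q:] * lam) \<cdot>\<^sub>m const_mat P - const_mat (R * adj_mat Q * transpose_mat R))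
     = [:det P * det Q ^ n:] *
       det ((lam - 1) \<cdot>\<^sub>m 1\<^sub>m n + lam \<cdot>\<^sub>m const_mat (P * Q)))"

definition hat_lhs :: "'a :: comm_ring_1 mat \<Rightarrow> 'a vec \<Rightarrow> 'a vec \<Rightarrow> 'a poly" where
  "hat_lhs A v w = (let Ph = P_hat A v; Qh = Q_hat A v w; Rh = R_hat A v w in
     [:det (N_hat A v w):] *
       det (([:(delta_R A v w)\<^sup>2 * det Qh:] * lam) \<cdot>\<^sub>m const_mat Ph
            - const_mat ((delta_P A * delta_Q A v w) \<cdot>\<^sub>m (Rh * adj_mat Qh * transpose_mat Rh))))"

definition hat_rhs :: "'a :: comm_ring_1 mat \<Rightarrow> 'a vec \<Rightarrow> 'a vec \<Rightarrow> 'a poly" where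
  "hat_rhs A v w = (let n = dim_row A; Ph = P_hat A v; Qh = Q_hat A v w in
     [:delta_R A v w ^ (2 * n) * det Ph * det Qh ^ n:] *
       det (((lam - 1) * [:delta_P A * delta_Q A v w:]) \<cdot>\<^sub>m 1\<^sub>m n
            + lam \<cdot>\<^sub>m const_mat (Ph * Qh)))"

text \<open>The ring \<open>\<real>[A, v, w]\<close>: a monomial is a finitely supported exponent function on the
  indeterminates, a polynomial a finitely supported coefficient function on monomials.\<close>

datatype indet = VarA nat nat | Varv nat | Varw nat

type_synonym param_poly = "(indet \<Rightarrow>\<^sub>0 nat) \<Rightarrow>\<^sub>0 real"

definition indet_poly :: "indet \<Rightarrow> param_poly" where
  "indet_poly x = Poly_Mapping.single (Poly_Mapping.single x 1) 1"

definition generic_A :: "nat \<Rightarrow> param_poly mat" where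
  "generic_A n = mat n n (\<lambda>(i, j). indet_poly (VarA i j))"

definition generic_v :: "nat \<Rightarrow> param_poly vec" where
  "generic_v n = vec n (\<lambda>i. indet_poly (Varv i))"

definition generic_w :: "nat \<Rightarrow> param_poly vec" where
  "generic_w n = vec n (\<lambda>i. indet_poly (Varw i))"

definition c_hat :: "nat \<Rightarrow> nat \<Rightarrow> param_poly" where
  "c_hat n k = coeff (hat_lhs (generic_A n) (generic_v n) (generic_w n)
                      - hat_rhs (generic_A n) (generic_v n) (generic_w n)) k"

fun indet_val :: "real mat \<Rightarrow> real vec \<Rightarrow> real vec \<Rightarrow> indet \<Rightarrow> real" where
  "indet_val A v w (VarA i j) = A $$ (i, j)"
| "indet_val A v w (Varv i) = v $ i"
| "indet_val A v w (Varw i) = w $ i"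

definition eval_at :: "real mat \<Rightarrow> real vec \<Rightarrow> real vec \<Rightarrow> param_poly \<Rightarrow> real" where
  "eval_at A v w p = (\<Sum>m\<in>Poly_Mapping.keys p. Poly_Mapping.lookup p m *
     (\<Prod>x\<in>Poly_Mapping.keys m. indet_val A v w x ^ Poly_Mapping.lookup m x))"

definition spectrum_mset :: "real mat \<Rightarrow> complex multiset" where
  "spectrum_mset M = proots (char_poly (map_mat complex_of_real M))"

text \<open>Meaningful for invertible matrices only.\<close>

definition inv_mat :: "real mat \<Rightarrow> real mat" where
  "inv_mat M = the (mat_inverse M)"

end

(*
  With z = A^T P^-1 v, tau = 1 - v^T P^-1 v, y = z - tau w and X = P^-1 + Q, uniqueness of solutions of
  Stein equations yields, for generic parameters,
    tau (P^-1 - A^T P^-1 A) = z z^T,   hence   tau (X - A2^T X A2) = y y^T.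
  A symmetric B with B A = A^T B and B v = z gives K = P B with K P K^T = tau P and K - A K A2 = v y^T.
  A polynomial T in A2 with T^T w = y gives K = R T and tau X = T^T Q T.
  So the pencil det(Q) lambda P - R adj(Q) R^T is carried by invertible factors to lambda P X - I, which is
  (lambda - 1) I + lambda P Q. Genericity (A, P and two Krylov matrices nonsingular) is removed by
  restricting the polynomial identity to a line through one explicit generic point.
*)
theory Submission
  imports Defs
begin

section \<open>Outer products and square matrices\<close>

text \<open>Where \<open>Q\<close> and \<open>1 + P Q\<close> are invertible as well, the relations
  amount to an explicit similarity: P^-1 R Q^-1 R^T = B (1 + P Q)^-1 B^-1. Indeed R Q^-1 R^T = K
  (\<tau> X)^-1 K^T because K = R T, and K^T = B P = \<tau> P^-1 B^-1. This is within reach because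
  every inhomogeneous term has rank one. A matrix commuting with a coefficient of a Stein equation
  maps solutions to solutions and only moves the generating vector, so two solutions agree once
  their vectors do. The update v w^T in \<open>F\<close> is what lets the cross terms of P^-1 and
  \<open>Q\<close> complete a square, y y^T. The auxiliary matrices cannot be had at every point of
  the domain: A = 0, v = 0 lies in it and gives P = 0. A direct pointwise argument therefore fails.
  On a line towards a nondegenerate point the obstruction becomes one nonzero real polynomial in one
  variable, and this can be cancelled from a product that vanishes at every real number.\<close>

lemma outer_carrier [simp]: "v \<in> carrier_vec n \<Longrightarrow> w \<in> carrier_vec m \<Longrightarrow> outer v w \<in> carrier_mat n m"
  by (simp add: outer_def)

lemma outer_index [simp]: "i < dim_vec v \<Longrightarrow> j < dim_vec w \<Longrightarrow> outer v w $$ (i, j) = v $ i * w $ j"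
  "dim_row (outer v w) = dim_vec v" "dim_col (outer v w) = dim_vec w"
  by (auto simp: outer_def)

lemma transpose_outer: "transpose_mat (outer v w) = outer w v"
  by (rule eq_matI) (auto simp: mult.commute)

lemma mult_outer:
  assumes "M \<in> carrier_mat m n" "v \<in> carrier_vec n"
  shows "M * outer v w = outer (M *\<^sub>v v) w"
  using assms by (intro eq_matI) (auto simp: scalar_prod_def sum_distrib_right mult.assoc)

lemma outer_mult:
  assumes "M \<in> carrier_mat n m" "w \<in> carrier_vec n"
  shows "outer v w * M = outer v (transpose_mat M *\<^sub>v w)"
  using assms by (intro eq_matI) (auto simp: scalar_prod_def sum_distrib_left ac_simps)

lemma outer_mult_outer:
  assumes "w \<in> carrier_vec n" "x \<in> carrier_vec n"
  shows "outer v w * outer x y = (w \<bullet> x) \<cdot>\<^sub>m outer v y"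
  using assms by (intro eq_matI) (auto simp: scalar_prod_def sum_distrib_left sum_distrib_right ac_simps)

lemma outer_mult_vec:
  assumes "w \<in> carrier_vec n" "x \<in> carrier_vec n"
  shows "outer v w *\<^sub>v x = (w \<bullet> x) \<cdot>\<^sub>v v"
  using assms by (intro eq_vecI) (auto simp: scalar_prod_def sum_distrib_left sum_distrib_right ac_simps)

context fixes n :: nat begin

lemma sq_carrier:
  "A \<in> carrier_mat n n \<Longrightarrow> B \<in> carrier_mat n n \<Longrightarrow> A * B \<in> carrier_mat n n"
  "A \<in> carrier_mat n n \<Longrightarrow> B \<in> carrier_mat n n \<Longrightarrow> A + B \<in> carrier_mat n n"
  "A \<in> carrier_mat n n \<Longrightarrow> B \<in> carrier_mat n n \<Longrightarrow> A - B \<in> carrier_mat n n"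
  "A \<in> carrier_mat n n \<Longrightarrow> x \<in> carrier_vec n \<Longrightarrow> A *\<^sub>v x \<in> carrier_vec n"
  for A B :: "'a :: comm_ring_1 mat"
  by auto

text \<open>Oriented as a normal form: products associate to the right, scalars move to the front,
  transposes move inwards, and matrices next to an outer product are absorbed into its vectors.
  Distributivity is kept apart in \<open>sq_distrib\<close>, since expanding sums is only sometimes
  wanted.\<close>

lemmas sq = sq_carrier assoc_mult_mat[of _ n n _ n _ n] assoc_mult_mat_vec[of _ n n _ n]
  mult_smult_distrib[of _ n n _ n] mult_smult_assoc_mat[of _ n n _ n]
  transpose_mult[of _ n n _ n] transpose_add[of _ n n] transpose_minus[of _ n n]
  mult_outer[of _ n n] outer_mult[of _ n n]

lemmas sq_distrib = mult_add_distrib_mat[of _ n n _ n] add_mult_distrib_mat[of _ n n _ _ n]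
  mult_minus_distrib_mat[of _ n n _ n] minus_mult_distrib_mat[of _ n n _ _ n]

lemma mat_eqI: "A \<in> carrier_mat n n \<Longrightarrow> B \<in> carrier_mat n n \<Longrightarrow>
  (\<And>i j. i < n \<Longrightarrow> j < n \<Longrightarrow> A $$ (i, j) = B $$ (i, j)) \<Longrightarrow> A = B"
  by (intro eq_matI) auto

lemma vec_mult_scalar:
  fixes M :: "'a :: comm_ring_1 mat"
  assumes "M \<in> carrier_mat n n" "x \<in> carrier_vec n" "y \<in> carrier_vec n"
  shows "(transpose_mat M *\<^sub>v x) \<bullet> y = x \<bullet> (M *\<^sub>v y)"
  using transpose_vec_mult_scalar[OF assms(1,3,2)] assms
  by (metis comm_scalar_prod mult_mat_vec_carrier transpose_carrier_mat transpose_transpose)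

end

section \<open>Krylov matrices\<close>

definition krylov :: "'a :: comm_ring_1 mat \<Rightarrow> 'a vec \<Rightarrow> 'a mat" where
  "krylov F b = mat (dim_row F) (dim_row F) (\<lambda>(i, j). (F ^\<^sub>m j *\<^sub>v b) $ i)"

lemma krylov_carrier [simp]: "F \<in> carrier_mat n n \<Longrightarrow> krylov F b \<in> carrier_mat n n"
  by (auto simp: krylov_def)

lemma krylov_index:
  "F \<in> carrier_mat n n \<Longrightarrow> i < n \<Longrightarrow> j < n \<Longrightarrow> krylov F b $$ (i, j) = (F ^\<^sub>m j *\<^sub>v b) $ i"
  by (auto simp: krylov_def)

lemma smult_smult_mat: "a \<cdot>\<^sub>m (b \<cdot>\<^sub>m M) = (a * b) \<cdot>\<^sub>m M" for a b :: "'a :: comm_ring_1"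
  by (rule eq_matI) (auto simp: mult.assoc)

lemma one_smult_mat [simp]: "(1 :: 'a :: comm_ring_1) \<cdot>\<^sub>m M = M"
  by (rule eq_matI) auto

lemma inverse_if_det_nonzero:
  fixes C :: "'a :: field mat"
  assumes C: "C \<in> carrier_mat n n" and "det C \<noteq> 0"
  obtains D where "D \<in> carrier_mat n n" "C * D = 1\<^sub>m n" "D * C = 1\<^sub>m n"
proof
  let ?D = "(1 / det C) \<cdot>\<^sub>m adj_mat C"
  show "?D \<in> carrier_mat n n" using adj_mat(1)[OF C] by simp
  show "C * ?D = 1\<^sub>m n"
    using mult_smult_distrib[OF C adj_mat(1)[OF C]] adj_mat(2)[OF C] assms
    by (auto simp: smult_smult_mat)
  show "?D * C = 1\<^sub>m n"
    using mult_smult_assoc_mat[OF adj_mat(1)[OF C] C] adj_mat(3)[OF C] assms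
    by (auto simp: smult_smult_mat)
qed

lemma pow_mat_commute:
  fixes F :: "'a :: comm_ring_1 mat"
  assumes F: "F \<in> carrier_mat n n"
  shows "F ^\<^sub>m k * F = F * F ^\<^sub>m k"
proof (induction k)
  case (Suc k)
  have "F ^\<^sub>m Suc k * F = (F * F ^\<^sub>m k) * F" by (simp add: Suc)
  also have "\<dots> = F * (F ^\<^sub>m k * F)" by (rule assoc_mult_mat[OF F pow_carrier_mat[OF F] F])
  finally show ?case by simp
qed (use F in simp)

lemma transpose_pow:
  fixes F :: "'a :: comm_ring_1 mat"
  assumes F: "F \<in> carrier_mat n n"
  shows "transpose_mat (F ^\<^sub>m k) = transpose_mat F ^\<^sub>m k"
proof (induction k)
  case (Suc k)
  have "transpose_mat (F ^\<^sub>m Suc k) = transpose_mat (F * F ^\<^sub>m k)"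
    by (simp add: pow_mat_commute[OF F])
  also have "\<dots> = transpose_mat F ^\<^sub>m k * transpose_mat F"
    using Suc transpose_mult[OF F pow_carrier_mat[OF F, of k]] by simp
  finally show ?case by simp
qed (use F in simp)

lemma pow_Suc_vec:
  fixes F :: "'a :: comm_ring_1 mat"
  assumes F: "F \<in> carrier_mat n n" and b: "b \<in> carrier_vec n"
  shows "F ^\<^sub>m Suc k *\<^sub>v b = F *\<^sub>v (F ^\<^sub>m k *\<^sub>v b)"
  using assoc_mult_mat_vec[OF F pow_carrier_mat[OF F, of k] b] by (simp add: pow_mat_commute[OF F])

lemma pow_add_vec:
  fixes F :: "'a :: comm_ring_1 mat"
  assumes F: "F \<in> carrier_mat n n" and b: "b \<in> carrier_vec n"
  shows "F ^\<^sub>m (j + k) *\<^sub>v b = F ^\<^sub>m j *\<^sub>v (F ^\<^sub>m k *\<^sub>v b)"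
proof (induction j)
  case 0
  show ?case using F b mult_mat_vec_carrier[OF pow_carrier_mat[OF F] b, of k] by simp
next
  case (Suc j)
  have "F ^\<^sub>m k *\<^sub>v b \<in> carrier_vec n"
    using mult_mat_vec_carrier[OF pow_carrier_mat[OF F] b] .
  then show ?case using Suc by (simp add: pow_Suc_vec[OF F] b del: pow_mat.simps)
qed

text \<open>The nonsingular Krylov matrix makes \<open>b\<close> a cyclic vector: y is a combination
  of the vectors F^j b, and the same combination of the powers F^j is the required polynomial in
  \<open>F\<close>.\<close>

lemma commuting_mat_of_krylov:
  fixes F :: "'a :: field mat"
  assumes F: "F \<in> carrier_mat n n" and b: "b \<in> carrier_vec n" and y: "y \<in> carrier_vec n"
    and "det (krylov F b) \<noteq> 0"
  obtains T where "T \<in> carrier_mat n n" "T * F = F * T" "T *\<^sub>v b = y"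
proof -
  note pow = pow_carrier_mat[OF F]
  obtain D where D: "D \<in> carrier_mat n n" "krylov F b * D = 1\<^sub>m n"
    using inverse_if_det_nonzero[OF krylov_carrier[OF F]] assms(4) by metis
  define c where "c = D *\<^sub>v y"
  have c: "c \<in> carrier_vec n" using D y by (simp add: c_def)
  have yc: "krylov F b *\<^sub>v c = y"
    using D y F unfolding c_def
    by (subst assoc_mult_mat_vec[symmetric, of _ n n _ n]) auto
  \<comment> \<open>The polynomial with coefficient vector \<open>c\<close>, given entrywise so that
    only scalar sums have to be exchanged.\<close>
  define T where "T = mat n n (\<lambda>(i, l). \<Sum>j<n. c $ j * (F ^\<^sub>m j) $$ (i, l))"
  have T: "T \<in> carrier_mat n n" by (simp add: T_def)
  have comm: "F ^\<^sub>m j * F = F * F ^\<^sub>m j" for j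
    by (rule pow_mat_commute[OF F])
  have TF: "(T * F) $$ (i, l) = (\<Sum>j<n. c $ j * (F ^\<^sub>m j * F) $$ (i, l))" if "i < n" "l < n" for i l
  proof -
    have "(T * F) $$ (i, l) = (\<Sum>k<n. (\<Sum>j<n. c $ j * (F ^\<^sub>m j) $$ (i, k)) * F $$ (k, l))"
      using that T F by (auto simp: scalar_prod_def T_def atLeast0LessThan)
    also have "\<dots> = (\<Sum>k<n. \<Sum>j<n. c $ j * ((F ^\<^sub>m j) $$ (i, k) * F $$ (k, l)))"
      by (simp add: sum_distrib_right mult.assoc)
    also have "\<dots> = (\<Sum>j<n. c $ j * (\<Sum>k<n. (F ^\<^sub>m j) $$ (i, k) * F $$ (k, l)))"
      by (subst sum.swap) (simp add: sum_distrib_left)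
    also have "\<dots> = (\<Sum>j<n. c $ j * (F ^\<^sub>m j * F) $$ (i, l))"
      using that F pow by (auto simp: scalar_prod_def atLeast0LessThan)
    finally show ?thesis .
  qed
  have FT: "(F * T) $$ (i, l) = (\<Sum>j<n. c $ j * (F * F ^\<^sub>m j) $$ (i, l))" if "i < n" "l < n" for i l
  proof -
    have "(F * T) $$ (i, l) = (\<Sum>k<n. F $$ (i, k) * (\<Sum>j<n. c $ j * (F ^\<^sub>m j) $$ (k, l)))"
      using that T F by (auto simp: scalar_prod_def T_def atLeast0LessThan)
    also have "\<dots> = (\<Sum>k<n. \<Sum>j<n. c $ j * (F $$ (i, k) * (F ^\<^sub>m j) $$ (k, l)))"
      by (simp add: sum_distrib_left mult.left_commute)
    also have "\<dots> = (\<Sum>j<n. c $ j * (\<Sum>k<n. F $$ (i, k) * (F ^\<^sub>m j) $$ (k, l)))"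
      by (subst sum.swap) (simp add: sum_distrib_left)
    also have "\<dots> = (\<Sum>j<n. c $ j * (F * F ^\<^sub>m j) $$ (i, l))"
      using that F pow by (auto simp: scalar_prod_def atLeast0LessThan)
    finally show ?thesis .
  qed
  have "T * F = F * T"
    by (rule mat_eqI[of _ n]) (use T F in \<open>auto simp: TF FT comm simp del: index_mult_mat(1)\<close>)
  moreover have "T *\<^sub>v b = y"
  proof (rule eq_vecI)
    fix i assume "i < dim_vec y"
    then have i: "i < n" using y by simp
    have "(T *\<^sub>v b) $ i = (\<Sum>l<n. (\<Sum>j<n. c $ j * (F ^\<^sub>m j) $$ (i, l)) * b $ l)"
      using i T b by (auto simp: scalar_prod_def T_def atLeast0LessThan)
    also have "\<dots> = (\<Sum>l<n. \<Sum>j<n. (F ^\<^sub>m j) $$ (i, l) * b $ l * c $ j)"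
      by (simp add: sum_distrib_left sum_distrib_right mult_ac)
    also have "\<dots> = (\<Sum>j<n. (\<Sum>l<n. (F ^\<^sub>m j) $$ (i, l) * b $ l) * c $ j)"
      by (subst sum.swap) (simp add: sum_distrib_right)
    also have "\<dots> = (krylov F b *\<^sub>v c) $ i"
      using i F b c pow by (auto simp: scalar_prod_def krylov_def atLeast0LessThan)
    finally show "(T *\<^sub>v b) $ i = y $ i" by (simp add: yc)
  qed (use T y in auto)
  ultimately show ?thesis using T that by blast
qed

text \<open>Take B = Z C^-1, which sends A^j v to (A^T)^j z. As a bilinear form on the basis A^j v
  it has the entries z^T A^(i+j) v. This is a Hankel matrix, hence symmetric, and applying
  \<open>A\<close> to either argument raises the order of the moment in the same way, which is the
  intertwining relation. The vector \<open>v\<close> itself is column 0, present because n is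
  positive.\<close>

lemma symmetric_intertwiner_of_krylov:
  fixes A :: "'a :: field mat"
  assumes A: "A \<in> carrier_mat n n" and v: "v \<in> carrier_vec n" and z: "z \<in> carrier_vec n"
    and "det (krylov A v) \<noteq> 0" and "0 < n"
  obtains B where "B \<in> carrier_mat n n" "transpose_mat B = B" "B * A = transpose_mat A * B" "B *\<^sub>v v = z"
proof -
  define C where "C = krylov A v"
  define Z where "Z = krylov (transpose_mat A) z"
  have At: "transpose_mat A \<in> carrier_mat n n" using A by simp
  have C: "C \<in> carrier_mat n n" and Z: "Z \<in> carrier_mat n n"
    using A by (auto simp: C_def Z_def)
  note pow = pow_carrier_mat[OF A] pow_carrier_mat[OF At]
  note powv = mult_mat_vec_carrier[OF pow(1) v] mult_mat_vec_carrier[OF pow(2) z]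
   
  obtain D where D: "D \<in> carrier_mat n n" "C * D = 1\<^sub>m n" "D * C = 1\<^sub>m n"
    using inverse_if_det_nonzero[OF C] assms(4) C_def by metis
  have DtCt: "transpose_mat D * transpose_mat C = 1\<^sub>m n"
    using transpose_mult[OF C D(1)] D by simp
  have colC: "col C j = A ^\<^sub>m j *\<^sub>v v" if "j < n" for j
    using that A v pow by (intro eq_vecI) (auto simp: C_def krylov_def)
  have colZ: "col Z j = transpose_mat A ^\<^sub>m j *\<^sub>v z" if "j < n" for j
    using that A z pow by (intro eq_vecI) (auto simp: Z_def krylov_def)
  \<comment> \<open>Moments depend on i + j alone; this is the Hankel structure behind both symmetry
    and intertwining.\<close>
  have moment: "(A ^\<^sub>m i *\<^sub>v v) \<bullet> (transpose_mat A ^\<^sub>m j *\<^sub>v z) = (A ^\<^sub>m (i + j) *\<^sub>v v) \<bullet> z" for i j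
  proof -
    have "(A ^\<^sub>m i *\<^sub>v v) \<bullet> (transpose_mat A ^\<^sub>m j *\<^sub>v z) = (transpose_mat (A ^\<^sub>m j) *\<^sub>v z) \<bullet> (A ^\<^sub>m i *\<^sub>v v)"
      unfolding transpose_pow[OF A] by (rule comm_scalar_prod[OF powv])
    also have "\<dots> = z \<bullet> (A ^\<^sub>m j *\<^sub>v (A ^\<^sub>m i *\<^sub>v v))"
      by (rule vec_mult_scalar[OF pow(1) z powv(1)])
    also have "\<dots> = z \<bullet> (A ^\<^sub>m (i + j) *\<^sub>v v)"
      by (metis pow_add_vec[OF A v] add.commute)
    also have "\<dots> = (A ^\<^sub>m (i + j) *\<^sub>v v) \<bullet> z"
      by (rule comm_scalar_prod[OF z powv(1)])
    finally show ?thesis .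
  qed
  have moment': "(transpose_mat A ^\<^sub>m i *\<^sub>v z) \<bullet> (A ^\<^sub>m j *\<^sub>v v) = (A ^\<^sub>m (i + j) *\<^sub>v v) \<bullet> z" for i j
    using moment[of j i] comm_scalar_prod[OF powv(1)[of j] powv(2)[of i]]
    by (simp add: add.commute)
  have ZtC: "transpose_mat Z * C = transpose_mat C * Z"
    using C Z by (intro mat_eqI[of _ n]) (auto simp: colC colZ moment moment')
  define B where "B = Z * D"
  have B: "B \<in> carrier_mat n n" using Z D by (simp add: B_def)
  have BC: "B * C = Z" using Z D C by (simp add: B_def)
  have "transpose_mat B = transpose_mat D * transpose_mat Z * (C * D)"
    using Z D by (simp add: B_def transpose_mult[of _ n n _ n])
  also have "\<dots> = transpose_mat D * (transpose_mat Z * C) * D"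
    using Z D(1) C by (simp add: assoc_mult_mat[of _ n n _ n _ n] sq_carrier[of _ n])
  also have "\<dots> = transpose_mat D * transpose_mat C * (Z * D)"
    unfolding ZtC
    using Z D(1) C by (simp add: assoc_mult_mat[of _ n n _ n _ n] sq_carrier[of _ n])
  finally have Bsym: "transpose_mat B = B"
    unfolding DtCt using left_mult_one_mat[OF B] by (simp add: B_def)
  have CtB: "transpose_mat C * B = transpose_mat Z"
    using transpose_mult[OF B C] BC Bsym by simp
  have colAC: "col (A * C) j = A ^\<^sub>m Suc j *\<^sub>v v" if "j < n" for j
    using that A C v col_mult2[OF A C that] by (simp add: colC pow_Suc_vec[OF A v, symmetric])
  \<comment> \<open>Tested on the Krylov basis, both sides become the matrix of moments of order i +
    j + 1.\<close>
  have eq: "transpose_mat C * (B * A) * C = transpose_mat C * (transpose_mat A * B) * C"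
  proof -
    have "transpose_mat C * (B * A) * C = transpose_mat Z * (A * C)"
      unfolding CtB[symmetric] using A B C by (simp add: assoc_mult_mat[of _ n n _ n _ n] sq_carrier[of _ n])
    moreover have "transpose_mat C * (transpose_mat A * B) * C = transpose_mat (A * C) * Z"
      unfolding BC[symmetric] using A B C
      by (simp add: assoc_mult_mat[of _ n n _ n _ n] sq_carrier[of _ n] transpose_mult[of _ n n _ n])
    moreover have "transpose_mat Z * (A * C) = transpose_mat (A * C) * Z"
    proof (rule mat_eqI[of _ n])
      fix i j assume ij: "i < n" "j < n"
      have "(transpose_mat Z * (A * C)) $$ (i, j) = col Z i \<bullet> col (A * C) j"
        using ij A C Z by simp
      moreover have "(transpose_mat (A * C) * Z) $$ (i, j) = col (A * C) i \<bullet> col Z j"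
        using ij A C Z by simp
      ultimately show "(transpose_mat Z * (A * C)) $$ (i, j) = (transpose_mat (A * C) * Z) $$ (i, j)"
        using ij by (simp add: colAC colZ moment moment' del: pow_mat.simps)
    qed (use A C Z in auto)
    ultimately show ?thesis by simp
  qed
  have cancel: "transpose_mat D * (transpose_mat C * M * C) * D = M" if M: "M \<in> carrier_mat n n" for M
  proof -
    have "transpose_mat D * (transpose_mat C * M * C) * D
        = (transpose_mat D * transpose_mat C) * M * (C * D)"
      using M C D(1) by (simp add: assoc_mult_mat[of _ n n _ n _ n] sq_carrier[of _ n])
    then show ?thesis using M by (simp add: DtCt D)
  qed
  have comm: "B * A = transpose_mat A * B"
    using cancel[of "B * A"] cancel[of "transpose_mat A * B"] eq A B by (metis At sq_carrier(1))
  have "B *\<^sub>v v = B *\<^sub>v col C 0"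
    using colC[OF \<open>0 < n\<close>] A v by simp
  also have "\<dots> = col (B * C) 0"
    by (rule col_mult2[OF B C \<open>0 < n\<close>, symmetric])
  also have "\<dots> = z" using colZ[OF \<open>0 < n\<close>] z A by (simp add: BC)
  finally show ?thesis using that B Bsym comm by blast
qed

section \<open>Displacement equations of the Gramians\<close>

lemma transpose_smult: "transpose_mat (a \<cdot>\<^sub>m M) = a \<cdot>\<^sub>m transpose_mat M"
  by (rule eq_matI) auto

lemma smult_outer: "a \<cdot>\<^sub>m outer v w = outer v (a \<cdot>\<^sub>v w)"
  by (rule eq_matI) (auto simp: mult_ac)

text \<open>Subtraction behaves like that of a group only on matrices of one fixed size, so terms
  are moved across an equation entry by entry.\<close>

lemma mat_index_eq: "M = N \<Longrightarrow> M $$ (i, j) = N $$ (i, j)"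
  by simp

lemma eq_zero_if_mult_vec_eq_zero:
  fixes M :: "'a :: field mat"
  assumes "M \<in> carrier_mat n n" "det M \<noteq> 0" "x \<in> carrier_vec n" "M *\<^sub>v x = 0\<^sub>v n"
  shows "x = 0\<^sub>v n"
proof -
  obtain D where D: "D \<in> carrier_mat n n" "D * M = 1\<^sub>m n"
    using inverse_if_det_nonzero[OF assms(1,2)] by metis
  have "x = (D * M) *\<^sub>v x" using assms D by simp
  also have "\<dots> = D *\<^sub>v (M *\<^sub>v x)" by (rule assoc_mult_mat_vec[OF D(1) assms(1,3)])
  also have "\<dots> = 0\<^sub>v n" using assms D by auto
  finally show ?thesis .
qed

text \<open>The difference of two solutions solves the homogeneous equation. This is the engine of
  the argument: each key matrix identity is obtained by showing that its two sides satisfy one Stein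
  equation.\<close>

lemma affine_solution_unique:
  fixes G H X Y Z :: "'a :: comm_ring_1 mat"
  assumes uniq: "\<And>X. X \<in> carrier_mat n n \<Longrightarrow> X = G * X * H \<Longrightarrow> X = 0\<^sub>m n n"
    and car: "G \<in> carrier_mat n n" "H \<in> carrier_mat n n" "X \<in> carrier_mat n n" "Y \<in> carrier_mat n n" "Z \<in> carrier_mat n n"
    and X: "X = G * X * H + Z" and Y: "Y = G * Y * H + Z"
  shows "X = Y"
proof -
  have "G * (X - Y) * H = G * X * H - G * Y * H"
    using car by (simp add: sq[of _ n] sq_distrib[of _ n])
  also have "\<dots> = X - Y"
    using mat_index_eq[OF X] mat_index_eq[OF Y] car
    by (intro mat_eqI[of _ n]) (auto simp: sq[of _ n] simp del: index_mult_mat(1))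
  finally have "X - Y = 0\<^sub>m n n" using car by (intro uniq) auto
  then have "(X - Y) $$ (i, j) = 0" if "i < n" "j < n" for i j using that by simp
  then show ?thesis using car by (intro mat_eqI[of _ n]) auto
qed

text \<open>Uniqueness enters through homogeneous equations, which keeps vectorization out of this
  part. \<open>unique_A\<close> concerns the transposed equation, the one satisfied by the multiple
  \<open>\<tau> \<cdot>\<^sub>m W\<close> of the inverse of \<open>P\<close>.\<close>

locale gramians =
  fixes n :: nat and A P Q R :: "'a :: field mat" and v w :: "'a vec" and F :: "'a mat"
  assumes n: "0 < n"
    and A [simp]: "A \<in> carrier_mat n n" and v [simp]: "v \<in> carrier_vec n" and w [simp]: "w \<in> carrier_vec n"
    and P [simp]: "P \<in> carrier_mat n n" and Q [simp]: "Q \<in> carrier_mat n n" and R [simp]: "R \<in> carrier_mat n n"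
    and P_eq: "P = A * P * transpose_mat A + outer v v"
    and Q_eq: "Q = transpose_mat F * Q * F + outer w w"
    and R_eq: "R = A * R * F + outer v w"
    and F_def: "F = A + outer v w"
    and unique_P: "\<And>X. X \<in> carrier_mat n n \<Longrightarrow> X = A * X * transpose_mat A \<Longrightarrow> X = 0\<^sub>m n n"
    and unique_A: "\<And>X. X \<in> carrier_mat n n \<Longrightarrow> X = transpose_mat A * X * A \<Longrightarrow> X = 0\<^sub>m n n"
    and unique_Q: "\<And>X. X \<in> carrier_mat n n \<Longrightarrow> X = transpose_mat F * X * F \<Longrightarrow> X = 0\<^sub>m n n"
    and unique_R: "\<And>X. X \<in> carrier_mat n n \<Longrightarrow> X = A * X * F \<Longrightarrow> X = 0\<^sub>m n n"
    and det_A: "det A \<noteq> 0" and det_P: "det P \<noteq> 0"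
    and ctrl: "det (krylov A v) \<noteq> 0" and obs: "det (krylov (transpose_mat F) w) \<noteq> 0"
begin

lemma F [simp]: "F \<in> carrier_mat n n" by (simp add: F_def)

lemma carriers [simp]: "transpose_mat A \<in> carrier_mat n n" "transpose_mat F \<in> carrier_mat n n"
  by simp_all

lemma dims [simp]: "dim_vec v = n" "dim_vec w = n"
  "dim_row A = n" "dim_col A = n" "dim_row P = n" "dim_col P = n" "dim_row Q = n" "dim_col Q = n"
  "dim_row F = n" "dim_col F = n"
  using carrier_vecD[OF v] carrier_vecD[OF w] carrier_matD[OF A] carrier_matD[OF P]
    carrier_matD[OF Q] carrier_matD[OF F] by auto

lemma P_sym: "transpose_mat P = P"
proof (rule affine_solution_unique[where G = A and H = "transpose_mat A" and Z = "outer v v", OF unique_P])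
  show "transpose_mat P = A * transpose_mat P * transpose_mat A + outer v v"
    by (subst P_eq) (simp add: sq[of _ n] transpose_outer)
qed (auto simp: P_eq[symmetric])

definition "W = (SOME D. D \<in> carrier_mat n n \<and> P * D = 1\<^sub>m n \<and> D * P = 1\<^sub>m n)"
definition "s = v \<bullet> (W *\<^sub>v v)"
definition "\<tau> = 1 - s"
definition "z = transpose_mat A *\<^sub>v (W *\<^sub>v v)"
definition "y = z - \<tau> \<cdot>\<^sub>v w"

lemma W_inverse: "W \<in> carrier_mat n n \<and> P * W = 1\<^sub>m n \<and> W * P = 1\<^sub>m n"
  unfolding W_def
  by (rule someI_ex) (use inverse_if_det_nonzero[OF P det_P] in metis)

lemma W [simp]: "W \<in> carrier_mat n n" and P_W: "P * W = 1\<^sub>m n" and W_P: "W * P = 1\<^sub>m n"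
  using W_inverse by blast+

lemma P_W_mult [simp]:
  "M \<in> carrier_mat n n \<Longrightarrow> P * (W * M) = M" "M \<in> carrier_mat n n \<Longrightarrow> W * (P * M) = M"
  "x \<in> carrier_vec n \<Longrightarrow> P *\<^sub>v (W *\<^sub>v x) = x" "x \<in> carrier_vec n \<Longrightarrow> W *\<^sub>v (P *\<^sub>v x) = x"
  by (simp_all add: assoc_mult_mat[of _ n n _ n _ n, symmetric] assoc_mult_mat_vec[of _ n n _ n, symmetric] P_W W_P
      del: assoc_mult_mat assoc_mult_mat_vec)

lemma W_sym: "transpose_mat W = W"
proof -
  have "transpose_mat W * P = 1\<^sub>m n"
    using transpose_mult[OF P W] by (simp add: P_W P_sym)
  then have "transpose_mat W * P * W = 1\<^sub>m n * W" by simp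
  moreover have "transpose_mat W * P * W = transpose_mat W * (P * W)"
    by (rule assoc_mult_mat[of _ n n _ n _ n]) auto
  ultimately show ?thesis using left_mult_one_mat[OF W] right_mult_one_mat[of "transpose_mat W" n n]
    by (simp add: P_W)
qed

lemma z [simp]: "z \<in> carrier_vec n"
  unfolding z_def by (intro sq_carrier(4)[of _ n]) auto

lemma y [simp]: "y \<in> carrier_vec n"
  unfolding y_def by simp

lemma W_v [simp]: "W *\<^sub>v v \<in> carrier_vec n"
  by (intro sq_carrier(4)[of _ n]) auto

lemma dims' [simp]: "dim_vec z = n" "dim_vec y = n" "dim_row W = n" "dim_col W = n"
  using carrier_vecD[OF z] carrier_vecD[OF y] carrier_matD[OF W] by auto

lemma A_P_At: "A * (P * transpose_mat A) = P - outer v v"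
proof (rule mat_eqI[of _ n])
  fix i j assume "i < n" "j < n"
  then show "(A * (P * transpose_mat A)) $$ (i, j) = (P - outer v v) $$ (i, j)"
    using mat_index_eq[OF P_eq, of i j] carrier_matD[OF A] carrier_vecD[OF v]
    by (simp add: sq[of _ n] del: index_mult_mat(1))
qed (auto simp: sq_carrier[of _ n])

text \<open>Insert z = A^T P^-1 v and A P A^T = P - v v^T. The relation lets a multiple of
  \<open>v\<close> be traded for an image of \<open>z\<close>, which is how rank-one terms in
  \<open>v\<close> turn into terms in \<open>z\<close>.\<close>

lemma A_P_z: "A *\<^sub>v (P *\<^sub>v z) = \<tau> \<cdot>\<^sub>v v"
proof -
  have "A *\<^sub>v (P *\<^sub>v z) = (A * (P * transpose_mat A)) *\<^sub>v (W *\<^sub>v v)"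
    by (simp add: z_def sq[of _ n])
  also have "\<dots> = P *\<^sub>v (W *\<^sub>v v) - outer v v *\<^sub>v (W *\<^sub>v v)"
    unfolding A_P_At by (rule minus_mult_distrib_mat_vec[of _ n n]) auto
  also have "\<dots> = v - s \<cdot>\<^sub>v v"
    by (simp add: outer_mult_vec[of _ n] s_def)
  also have "\<dots> = \<tau> \<cdot>\<^sub>v v"
    unfolding \<tau>_def using v by (intro eq_vecI) (auto simp: algebra_simps)
  finally show ?thesis .
qed

text \<open>By the matrix determinant lemma for A P A^T = P - v v^T, \<open>\<tau>\<close> is the
  square of det A. The proof argues with vectors instead: \<tau> = 0 forces A P z = 0, then z = 0,
  then W v = 0, and so \<tau> = 1.\<close>

lemma tau_nonzero: "\<tau> \<noteq> 0"
proof
  assume "\<tau> = 0"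
  have "A *\<^sub>v (P *\<^sub>v z) = 0\<^sub>v n"
    unfolding A_P_z using carrier_vecD[OF v] by (intro eq_vecI) (auto simp: \<open>\<tau> = 0\<close>)
  then have "P *\<^sub>v z = 0\<^sub>v n"
    by (rule eq_zero_if_mult_vec_eq_zero[OF A det_A sq_carrier(4)[OF P z]])
  then have "z = 0\<^sub>v n"
    by (rule eq_zero_if_mult_vec_eq_zero[OF P det_P z])
  moreover have "det (transpose_mat A) \<noteq> 0"
    using det_A by (simp add: det_transpose[OF A])
  ultimately have "W *\<^sub>v v = 0\<^sub>v n"
    by (intro eq_zero_if_mult_vec_eq_zero[OF carriers(1) _ W_v]) (simp_all add: z_def)
  then have "s = 0" by (simp add: s_def)
  with \<open>\<tau> = 0\<close> show False by (simp add: \<tau>_def)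
qed

text \<open>The equation of \<open>P\<close> is inverted: multiply A P A^T = P - v v^T by A^T W on
  the left and cancel P A^T on the right. The rank-one term left over contains \<open>v\<close>;
  scaled by \<open>\<tau>\<close> it becomes z z^T through \<open>A_P_z\<close>.\<close>

lemma W_displacement: "\<tau> \<cdot>\<^sub>m W = transpose_mat A * (\<tau> \<cdot>\<^sub>m W) * A + outer z z"
proof -
  obtain D where D: "D \<in> carrier_mat n n" "A * D = 1\<^sub>m n" "D * A = 1\<^sub>m n"
    using inverse_if_det_nonzero[OF A det_A] .
  let ?At = "transpose_mat A" and ?Dt = "transpose_mat D"
  have At_Dt: "?At * ?Dt = 1\<^sub>m n" using transpose_mult[OF D(1) A] D by simp
  have "?At * (W * (A * (P * ?At))) = ?At - outer z v"
    unfolding A_P_At by (simp add: sq[of _ n] sq_distrib[of _ n] P_W W_P z_def right_mult_one_mat[OF carriers(1)])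
  then have 1: "?At * (W * (A * (P * ?At))) * ?Dt * W = (?At - outer z v) * ?Dt * W"
    by simp
  have "?At * (W * (A * (P * ?At))) * ?Dt * W = ?At * (W * (A * (P * (?At * ?Dt * W))))"
    using D(1) by (simp add: sq[of _ n])
  also have "\<dots> = ?At * (W * A)"
    using right_mult_one_mat[OF A] unfolding At_Dt by (simp add: P_W sq[of _ n])
  finally have 2: "?At * (W * A) = (?At * ?Dt) * W - outer z v * ?Dt * W"
    unfolding 1 using D(1) by (simp add: sq[of _ n] sq_distrib[of _ n])
  have "\<tau> \<cdot>\<^sub>m (outer z v * ?Dt * W) = outer z (\<tau> \<cdot>\<^sub>v v) * (?Dt * W)"
    unfolding smult_outer[symmetric] using D(1)
    by (simp add: mult_smult_assoc_mat[of _ n n _ n] assoc_mult_mat[of _ n n _ n _ n])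
  also have "\<dots> = outer z z * (P * (?At * ?Dt * W))"
    unfolding A_P_z[symmetric] using D(1) by (simp add: sq[of _ n] P_sym)
  also have "\<dots> = outer z z"
    unfolding At_Dt by (simp add: P_W sq[of _ n])
  finally have 3: "\<tau> \<cdot>\<^sub>m (outer z v * ?Dt * W) = outer z z" .
  let ?U = "outer z v * ?Dt * W"
  have U: "?U \<in> carrier_mat n n" using D(1) by (simp add: sq_carrier[of _ n])
  show ?thesis
  proof (rule mat_eqI[of _ n])
    fix i j assume ij: "i < n" "j < n"
    have "(?At * (W * A)) $$ (i, j) = (W - ?U) $$ (i, j)"
      unfolding 2 At_Dt left_mult_one_mat[OF W] ..
    also have "\<dots> = W $$ (i, j) - ?U $$ (i, j)"
      using U ij by (simp del: index_mult_mat(1))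
    finally have "\<tau> * (?At * (W * A)) $$ (i, j) = \<tau> * W $$ (i, j) - \<tau> * ?U $$ (i, j)"
      by (simp only: right_diff_distrib)
    moreover have "\<tau> * ?U $$ (i, j) = z $ i * z $ j"
      using mat_index_eq[OF 3, of i j] U ij by (simp del: index_mult_mat(1))
    ultimately show "(\<tau> \<cdot>\<^sub>m W) $$ (i, j) = (?At * (\<tau> \<cdot>\<^sub>m W) * A + outer z z) $$ (i, j)"
      using ij by (simp add: sq[of _ n] del: index_mult_mat(1))
  qed (auto simp: sq_carrier[of _ n])
qed

text \<open>For the symmetric intertwiner \<open>B\<close>, moving \<open>A\<close> through
  \<open>B\<close> shows that B P B solves the equation of \<tau> W, so the two agree; K = P B is
  then a similitude of \<open>P\<close> with multiplier \<open>\<tau>\<close>. In A K F the rank-one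
  part of \<open>F\<close> contributes \<tau> v w^T, which changes the generator from
  \<open>z\<close> to \<open>y\<close>.\<close>

lemma exists_P_similitude:
  obtains K where "K \<in> carrier_mat n n" "K * P * transpose_mat K = \<tau> \<cdot>\<^sub>m P"
    "K = A * K * F + outer v y"
proof -
  obtain B where B: "B \<in> carrier_mat n n" "transpose_mat B = B" "B * A = transpose_mat A * B" "B *\<^sub>v v = z"
    using symmetric_intertwiner_of_krylov[OF A v z ctrl n] .
  have BPB: "B * (P * B) = \<tau> \<cdot>\<^sub>m W"
  proof (rule affine_solution_unique[where G = "transpose_mat A" and H = A and Z = "outer z z", OF unique_A])
    have "transpose_mat A * (B * (P * B)) * A = (transpose_mat A * B) * (P * (B * A))"
      using B(1) by (simp add: sq[of _ n])
    also have "\<dots> = (B * A) * (P * (transpose_mat A * B))"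
      by (simp only: B(3))
    also have "\<dots> = B * (A * (P * transpose_mat A)) * B"
      using B(1) by (simp add: sq[of _ n])
    also have "\<dots> = B * (P * B) - outer z z"
      unfolding A_P_At using B by (simp add: sq[of _ n] sq_distrib[of _ n])
    finally have 1: "transpose_mat A * (B * (P * B)) * A = B * (P * B) - outer z z" .
    show "B * (P * B) = transpose_mat A * (B * (P * B)) * A + outer z z"
      unfolding 1 using B(1) by (intro mat_eqI[of _ n]) (auto simp: sq_carrier[of _ n] simp del: index_mult_mat(1))
    show "\<tau> \<cdot>\<^sub>m W = transpose_mat A * (\<tau> \<cdot>\<^sub>m W) * A + outer z z"
      by (rule W_displacement)
  qed (use B(1) in \<open>auto simp: sq_carrier[of _ n]\<close>)
  define K where "K = P * B"
  have K: "K \<in> carrier_mat n n" using B(1) by (simp add: K_def sq_carrier[of _ n])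
  have "K * P * transpose_mat K = P * (B * (P * B) * P)"
    using B(1,2) by (simp add: K_def sq[of _ n] P_sym)
  also have "\<dots> = \<tau> \<cdot>\<^sub>m P"
    unfolding BPB by (simp add: sq[of _ n] W_P)
  finally have KPK: "K * P * transpose_mat K = \<tau> \<cdot>\<^sub>m P" .
  have "A * K * F = A * P * (B * A) + A * P * B * outer v w"
    using B(1) by (simp add: K_def F_def sq[of _ n] sq_distrib[of _ n])
  also have "A * P * (B * A) = A * (P * transpose_mat A) * B"
    unfolding B(3) using B(1) by (simp add: sq[of _ n])
  also have "\<dots> = K - outer v z"
    unfolding A_P_At K_def using B by (simp add: sq[of _ n] sq_distrib[of _ n])
  also have "A * P * B * outer v w = outer (\<tau> \<cdot>\<^sub>v v) w"
    using B by (simp add: sq[of _ n] A_P_z)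
  finally have AKF: "A * K * F = K - outer v z + outer (\<tau> \<cdot>\<^sub>v v) w" .
  have "K = A * K * F + outer v y"
    unfolding AKF using K v w z
    by (intro mat_eqI[of _ n]) (auto simp: y_def algebra_simps)
  with K KPK that show thesis by blast
qed

definition "X = W + Q"

lemma X [simp]: "X \<in> carrier_mat n n"
  by (simp add: X_def)

text \<open>A square is completed. Expanding F^T W F gives the cross terms -\<tau> (z w^T + w z^T),
  and the w w^T terms of \<open>W\<close> and \<open>Q\<close> add up to \<tau> (1 - s) = \<tau>^2.
  The vector \<open>y\<close> is chosen as the root of this square.\<close>

lemma X_displacement: "\<tau> \<cdot>\<^sub>m X = transpose_mat F * (\<tau> \<cdot>\<^sub>m X) * F + outer y y"
proof -
  have Ft: "transpose_mat F = transpose_mat A + outer w v"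
    by (simp add: F_def sq[of _ n] transpose_outer)
  have Wf: "W * F = W * A + outer (W *\<^sub>v v) w"
    by (simp add: F_def sq[of _ n] sq_distrib[of _ n])
  have "outer w v * (W * A) = outer w z"
    by (simp add: sq[of _ n] W_sym z_def)
  then have "transpose_mat F * (W * F) = transpose_mat A * (W * A) + outer z w + (outer w z + s \<cdot>\<^sub>m outer w w)"
    unfolding Wf Ft
    by (subst add_mult_distrib_mat[of _ n n _ _ n])
       (auto simp: sq_carrier[of _ n] mult_add_distrib_mat[of _ n n _ n] mult_outer[of "transpose_mat A" n n]
         outer_mult_outer[of _ n] s_def z_def)
  also have "\<dots> = transpose_mat A * (W * A) + outer z w + outer w z + s \<cdot>\<^sub>m outer w w"
    by (rule assoc_add_mat[symmetric]) (auto simp: sq_carrier[of _ n])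
  finally have "transpose_mat F * (W * F) = transpose_mat A * (W * A) + outer z w + outer w z + s \<cdot>\<^sub>m outer w w" .
  then have 1: "transpose_mat F * (\<tau> \<cdot>\<^sub>m X) * F = \<tau> \<cdot>\<^sub>m (transpose_mat A * (W * A) + outer z w + outer w z + s \<cdot>\<^sub>m outer w w + transpose_mat F * (Q * F))"
    by (simp add: X_def sq[of _ n] sq_distrib[of _ n])
  have 2: "\<tau> \<cdot>\<^sub>m W = \<tau> \<cdot>\<^sub>m (transpose_mat A * (W * A)) + outer z z"
    using W_displacement by (simp add: sq[of _ n])
  have 3: "Q = transpose_mat F * (Q * F) + outer w w"
    using Q_eq by (simp add: sq[of _ n])
  show ?thesis unfolding 1
  proof (rule mat_eqI[of _ n])
    fix i j assume ij: "i < n" "j < n"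
    have "(\<tau> \<cdot>\<^sub>m X) $$ (i, j) = (\<tau> \<cdot>\<^sub>m W) $$ (i, j) + \<tau> * Q $$ (i, j)"
      using ij by (simp add: X_def algebra_simps)
    moreover have "(\<tau> \<cdot>\<^sub>m W) $$ (i, j) = \<tau> * (transpose_mat A * (W * A)) $$ (i, j) + z $ i * z $ j"
      by (subst 2) (use ij in \<open>simp add: sq_carrier[of _ n] carrier_vecD[OF z] carrier_matD[OF A] del: index_mult_mat(1)\<close>)
    moreover have "Q $$ (i, j) = (transpose_mat F * (Q * F)) $$ (i, j) + w $ i * w $ j"
      by (subst 3) (use ij in \<open>simp add: sq_carrier[of _ n] carrier_vecD[OF w] carrier_matD[OF F] del: index_mult_mat(1)\<close>)
    ultimately have X: "(\<tau> \<cdot>\<^sub>m X) $$ (i, j) = \<tau> * (transpose_mat A * (W * A)) $$ (i, j) + z $ i * z $ j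
        + \<tau> * ((transpose_mat F * (Q * F)) $$ (i, j) + w $ i * w $ j)" by simp
    have s: "s = 1 - \<tau>" by (simp add: \<tau>_def)
    show "(\<tau> \<cdot>\<^sub>m X) $$ (i, j) = (\<tau> \<cdot>\<^sub>m (transpose_mat A * (W * A) + outer z w + outer w z + s \<cdot>\<^sub>m outer w w + transpose_mat F * (Q * F)) + outer y y) $$ (i, j)"
      unfolding X using ij
      by (simp add: y_def s algebra_simps del: index_mult_mat(1))
  qed (auto simp: sq_carrier[of _ n])
qed

text \<open>A matrix \<open>T\<close> commuting with \<open>F\<close> passes through the equations
  of \<open>Q\<close> and \<open>R\<close> and only replaces \<open>w\<close> by T^T w. It is found
  on the transposed side, where \<open>w\<close> is cyclic for F^T and can be sent to
  \<open>y\<close>.\<close>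

lemma exists_polynomial_in_F:
  obtains T where "T \<in> carrier_mat n n" "\<tau> \<cdot>\<^sub>m X = transpose_mat T * Q * T"
    "R * T = A * (R * T) * F + outer v y"
proof -
  obtain S where S: "S \<in> carrier_mat n n" "S * transpose_mat F = transpose_mat F * S" "S *\<^sub>v w = y"
    using commuting_mat_of_krylov[OF carriers(2) w y obs] .
  define T where "T = transpose_mat S"
  have T: "T \<in> carrier_mat n n" using S(1) by (simp add: T_def)
  have comm: "F * T = T * F"
    using arg_cong[OF S(2), of transpose_mat] S(1) by (simp add: T_def sq[of _ n])
  have Tw: "transpose_mat T *\<^sub>v w = y" using S by (simp add: T_def)
  have comm': "transpose_mat T * transpose_mat F = transpose_mat F * transpose_mat T"
    using S by (simp add: T_def)
  have "\<tau> \<cdot>\<^sub>m X = transpose_mat T * Q * T"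
  proof (rule affine_solution_unique[where G = "transpose_mat F" and H = F and Z = "outer y y", OF unique_Q])
    have "transpose_mat F * (transpose_mat T * Q * T) * F = (transpose_mat F * transpose_mat T) * Q * (T * F)"
      using T by (simp add: sq[of _ n])
    also have "\<dots> = transpose_mat T * (transpose_mat F * Q * F) * T"
      unfolding comm[symmetric] comm'[symmetric] using T by (simp add: sq[of _ n])
    finally have 1: "transpose_mat F * (transpose_mat T * Q * T) * F = transpose_mat T * (transpose_mat F * Q * F) * T" .
    have "transpose_mat T * Q * T = transpose_mat T * (transpose_mat F * Q * F + outer w w) * T"
      using Q_eq by simp
    also have "\<dots> = transpose_mat T * (transpose_mat F * Q * F) * T + outer y y"
      using T Tw by (simp add: sq[of _ n] sq_distrib[of _ n])
    finally show "transpose_mat T * Q * T = transpose_mat F * (transpose_mat T * Q * T) * F + outer y y"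
      unfolding 1 .
  qed (use T in \<open>auto simp: sq_carrier[of _ n] X_displacement[symmetric]\<close>)
  moreover have "R * T = A * (R * T) * F + outer v y"
  proof -
    have "R * T = (A * R * F + outer v w) * T" using R_eq by simp
    also have "\<dots> = A * R * (F * T) + outer v y"
      using T Tw by (simp add: sq[of _ n] sq_distrib[of _ n])
    also have "\<dots> = A * (R * T) * F + outer v y"
      unfolding comm using T by (simp add: sq[of _ n])
    finally show ?thesis .
  qed
  ultimately show thesis using T that by blast
qed

end

section \<open>The pencil identity\<close>

lemma const_mat_carrier [simp]: "const_mat M \<in> carrier_mat m n \<longleftrightarrow> M \<in> carrier_mat m n"
  by (simp add: const_mat_def)

lemma const_mat_dim [simp]: "dim_row (const_mat M) = dim_row M" "dim_col (const_mat M) = dim_col M"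
  by (simp_all add: const_mat_def)

interpretation const_poly_hom: comm_ring_hom "\<lambda>a :: 'a :: comm_ring_1. [:a:]"
  by unfold_locales auto

lemma det_const_mat: "det (const_mat M) = [:det M:]"
  unfolding const_mat_def by (rule const_poly_hom.hom_det)

lemma const_mat_mult:
  "M \<in> carrier_mat n n \<Longrightarrow> N \<in> carrier_mat n n \<Longrightarrow> const_mat (M * N) = const_mat M * const_mat N"
  unfolding const_mat_def by (rule const_poly_hom.mat_hom_mult)

lemma const_mat_one: "const_mat (1\<^sub>m n) = 1\<^sub>m n"
  unfolding const_mat_def by (rule const_poly_hom.mat_hom_one)

lemma const_mat_smult: "const_mat (a \<cdot>\<^sub>m M) = [:a:] \<cdot>\<^sub>m const_mat M"
  by (rule eq_matI) (auto simp: const_mat_def)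

lemma const_mat_add:
  "M \<in> carrier_mat n n \<Longrightarrow> N \<in> carrier_mat n n \<Longrightarrow> const_mat (M + N) = const_mat M + const_mat N"
  by (rule eq_matI) (auto simp: const_mat_def)

lemma smult_diff_mat:
  "M \<in> carrier_mat m n \<Longrightarrow> N \<in> carrier_mat m n \<Longrightarrow> a \<cdot>\<^sub>m (b \<cdot>\<^sub>m M - N) = (a * b) \<cdot>\<^sub>m M - a \<cdot>\<^sub>m N"
  for a b :: "'a :: comm_ring_1"
  by (rule eq_matI) (auto simp: algebra_simps)

context gramians
begin

text \<open>Right multiplication by \<open>J * X\<close> turns the left pencil into det Q times
  \<open>K\<close> times the right pencil. Determinants then leave a factor det X on the left, and
  det P * det X = det (1 + P Q) gives the stated form.\<close>

theorem pencil_identity: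
  "[:det (1\<^sub>m n + P * Q):] *
     det (([:det Q:] * lam) \<cdot>\<^sub>m const_mat P - const_mat (R * adj_mat Q * transpose_mat R))
   = [:det P * det Q ^ n:] * det ((lam - 1) \<cdot>\<^sub>m 1\<^sub>m n + lam \<cdot>\<^sub>m const_mat (P * Q))"
proof -
  obtain K where K: "K \<in> carrier_mat n n" "K * P * transpose_mat K = \<tau> \<cdot>\<^sub>m P"
    "K = A * K * F + outer v y" using exists_P_similitude .
  obtain T where T: "T \<in> carrier_mat n n" "\<tau> \<cdot>\<^sub>m X = transpose_mat T * Q * T"
    "R * T = A * (R * T) * F + outer v y" using exists_polynomial_in_F .
  note adj = adj_mat[OF Q]
  have RT: "R * T = K"
    by (rule affine_solution_unique[where G = A and H = F and Z = "outer v y", OF unique_R])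
       (use K T in \<open>auto simp: sq_carrier[of _ n]\<close>)
  \<comment> \<open>The similitude gives (det K)^2 = \<tau>^n, so \<open>K\<close> is invertible,
    and then so is \<open>T\<close> because K = R T.\<close>
  have "det K * det P * det K = \<tau> ^ n * det P"
    using arg_cong[OF K(2), of det] K(1)
    by (simp add: det_mult[of _ n] sq_carrier[of _ n] det_transpose)
  with tau_nonzero det_P have det_K: "det K \<noteq> 0" by auto
  then have det_T: "det T \<noteq> 0" using det_mult[OF R T(1)] RT by auto
  obtain D where D: "D \<in> carrier_mat n n" "K * D = 1\<^sub>m n" "D * K = 1\<^sub>m n"
    using inverse_if_det_nonzero[OF K(1) det_K] .
  obtain E where E: "E \<in> carrier_mat n n" "T * E = 1\<^sub>m n" "E * T = 1\<^sub>m n"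
    using inverse_if_det_nonzero[OF T(1) det_T] .
  have EtTt: "transpose_mat E * transpose_mat T = 1\<^sub>m n"
    using transpose_mult[OF T(1) E(1)] E by simp
  \<comment> \<open>This is \<open>\<tau>\<close> times the inverse transpose of \<open>K\<close>,
    as \<open>KtJ\<close> shows. Written as a conjugate of \<open>K\<close> it visibly has the
    determinant of \<open>K\<close>.\<close>
  define J where "J = W * K * P"
  have J: "J \<in> carrier_mat n n" using K by (simp add: J_def sq_carrier[of _ n])
  have "P * transpose_mat K = (D * K) * (P * transpose_mat K)"
    using K(1) by (simp add: D left_mult_one_mat[of _ n n] sq_carrier[of _ n])
  also have "\<dots> = D * (K * P * transpose_mat K)"
    using K(1) D(1) by (simp add: sq[of _ n])
  also have "\<dots> = \<tau> \<cdot>\<^sub>m (D * P)"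
    unfolding K(2) using D(1) by (simp add: sq[of _ n])
  finally have PKt: "P * transpose_mat K = \<tau> \<cdot>\<^sub>m (D * P)" .
  have "transpose_mat K * J = W * (P * transpose_mat K) * W * K * P"
    using K(1) by (simp add: J_def sq[of _ n])
  also have "\<dots> = \<tau> \<cdot>\<^sub>m (W * (D * (K * P)))"
    unfolding PKt using K(1) D(1) by (simp add: sq[of _ n])
  also have "D * (K * P) = P"
    using K(1) D by (simp add: assoc_mult_mat[of _ n n _ n _ n, symmetric] left_mult_one_mat[OF P] del: assoc_mult_mat)
  finally have KtJ: "transpose_mat K * J = \<tau> \<cdot>\<^sub>m 1\<^sub>m n" by (simp add: W_P)
  have "transpose_mat T * (transpose_mat R * (J * X)) = transpose_mat K * J * X"
    unfolding RT[symmetric] using T(1) J by (simp add: sq[of _ n])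
  also have "\<dots> = transpose_mat T * (Q * T)"
    unfolding KtJ using T by (simp add: sq[of _ n] left_mult_one_mat[OF X])
  finally have TRJX: "transpose_mat T * (transpose_mat R * (J * X)) = transpose_mat T * (Q * T)" .
  have cancel: "transpose_mat E * (transpose_mat T * M) = M" if "M \<in> carrier_mat n n" for M
    using that E(1) T(1) EtTt
    by (simp add: assoc_mult_mat[of _ n n _ n _ n, symmetric] left_mult_one_mat[OF that] del: assoc_mult_mat)
  have RJX: "transpose_mat R * (J * X) = Q * T"
    using arg_cong[OF TRJX, of "\<lambda>M. transpose_mat E * M"] J T(1) by (simp add: cancel sq_carrier[of _ n])
  let ?S = "R * adj_mat Q * transpose_mat R"
  have S: "?S \<in> carrier_mat n n" using adj by (simp add: sq_carrier[of _ n])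
  \<comment> \<open>The factor \<open>Q\<close> produced by \<open>RJX\<close> meets the adjugate,
    so only det Q appears and no inverse of \<open>Q\<close>.\<close>
  have "?S * (J * X) = R * (adj_mat Q * (transpose_mat R * (J * X)))"
    using J adj(1) by (simp add: sq[of _ n])
  also have "\<dots> = R * ((adj_mat Q * Q) * T)"
    unfolding RJX using T(1) adj(1) by (simp add: sq[of _ n])
  also have "\<dots> = det Q \<cdot>\<^sub>m K"
    unfolding adj(3) using T(1) by (simp add: sq[of _ n] left_mult_one_mat[OF T(1)] RT)
  finally have SJX: "?S * (J * X) = det Q \<cdot>\<^sub>m K" .
  have PJX: "P * (J * X) = K * (P * X)"
    using K(1) by (simp add: J_def sq[of _ n])
  have PX: "P * X = 1\<^sub>m n + P * Q"
    by (simp add: X_def sq_distrib[of _ n] P_W)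
  let ?L = "(lam - 1) \<cdot>\<^sub>m 1\<^sub>m n + lam \<cdot>\<^sub>m const_mat (P * Q)"
  let ?M = "([:det Q:] * lam) \<cdot>\<^sub>m const_mat P - const_mat ?S"
  have L: "?L \<in> carrier_mat n n" and M: "?M \<in> carrier_mat n n"
    using S by (auto simp: sq_carrier[of _ n] minus_carrier_mat)
  have L_eq: "?L = lam \<cdot>\<^sub>m const_mat (P * X) - 1\<^sub>m n"
    unfolding PX const_mat_add[OF one_carrier_mat sq_carrier(1)[OF P Q]] const_mat_one
    by (intro mat_eqI[of _ n]) (auto simp: sq_carrier[of _ n] algebra_simps)
  have "?M * const_mat (J * X) = ([:det Q:] * lam) \<cdot>\<^sub>m const_mat (P * (J * X)) - const_mat (?S * (J * X))"
    using J S by (simp add: minus_mult_distrib_mat[of _ n n _ _ n] const_mat_mult[of _ n] sq_carrier[of _ n]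
       mult_smult_assoc_mat[of _ n n _ n])
  also have "\<dots> = [:det Q:] \<cdot>\<^sub>m (lam \<cdot>\<^sub>m (const_mat K * const_mat (P * X)) - const_mat K)"
    unfolding PJX SJX const_mat_smult const_mat_mult[OF K(1) sq_carrier(1)[OF P X]]
    by (rule smult_diff_mat[symmetric]) (use K(1) in \<open>auto simp: sq_carrier[of _ n]\<close>)
  also have "lam \<cdot>\<^sub>m (const_mat K * const_mat (P * X)) - const_mat K = const_mat K * ?L"
    unfolding L_eq using K(1)
    by (simp add: sq_carrier[of _ n] mult_minus_distrib_mat[of _ n n _ n] mult_smult_distrib[of _ n n _ n]
        right_mult_one_mat[of _ n n])
  finally have "det ?M * [:det J * det X:] = [:det Q ^ n * det K:] * det ?L"
    using J K(1) L M
    by (drule_tac arg_cong[of _ _ det])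
       (simp add: det_mult[of _ n] const_mat_mult[of _ n] det_const_mat poly_const_pow mult.commute)
  moreover have "det J = det K"
  proof -
    have "det J = (det P * det W) * det K"
      using K(1) by (simp add: J_def det_mult[of _ n] sq_carrier[of _ n])
    also have "det P * det W = 1"
      using det_mult[OF P W] by (simp add: P_W)
    finally show ?thesis by simp
  qed
  ultimately have "[:det K:] * (det ?M * [:det X:]) = [:det K:] * ([:det Q ^ n:] * det ?L)"
    by (simp add: mult_ac)
  then have MX: "det ?M * [:det X:] = [:det Q ^ n:] * det ?L"
    using det_K by (simp only: mult_cancel_left) auto
  have "det (1\<^sub>m n + P * Q) = det P * det X"
    unfolding PX[symmetric] by (rule det_mult[OF P X])
  then have "[:det (1\<^sub>m n + P * Q):] * det ?M = [:det P:] * (det ?M * [:det X:])"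
    by (simp add: mult_ac)
  then show ?thesis unfolding MX by (simp add: mult_ac)
qed

end

section \<open>Stein equations through Kronecker products\<close>

text \<open>Division with remainder by n enumerates the pairs (l, i) as k = l n + i, the index
  convention of both \<open>kron\<close> and \<open>vec_of_mat\<close>.\<close>

lemma sum_div_mod:
  fixes f :: "nat \<Rightarrow> nat \<Rightarrow> 'a :: comm_monoid_add"
  shows "(\<Sum>k<m * n. f (k div n) (k mod n)) = (\<Sum>l<m. \<Sum>i<n. f l i)"
proof (cases "n = 0")
  case False
  have "(\<Sum>l<m. \<Sum>i<n. f l i) = (\<Sum>(l, i)\<in>{..<m} \<times> {..<n}. f l i)"
    by (simp add: sum.cartesian_product)
  also have "\<dots> = (\<Sum>k<m * n. f (k div n) (k mod n))"
  proof (rule sum.reindex_bij_witness[where i = "\<lambda>k. (k div n, k mod n)" and j = "\<lambda>(l, i). l * n + i"])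
    fix p assume "p \<in> {..<m} \<times> {..<n}"
    then obtain l i where p: "p = (l, i)" "l < m" "i < n" by auto
    have "l * n + i < (l + 1) * n" using p by simp
    also have "\<dots> \<le> m * n" using p by (intro mult_right_mono) auto
    finally show "(case p of (l, i) \<Rightarrow> l * n + i) \<in> {..<m * n}" using p by simp
  qed (use False in \<open>auto simp: less_mult_imp_div_less\<close>)
  finally show ?thesis by simp
qed simp

lemma kron_carrier:
  "F \<in> carrier_mat n n \<Longrightarrow> G \<in> carrier_mat n n \<Longrightarrow> kron F G \<in> carrier_mat (n * n) (n * n)"
  by (auto simp: kron_def)

lemma I_minus_kron_carrier:
  "F \<in> carrier_mat n n \<Longrightarrow> G \<in> carrier_mat n n \<Longrightarrow> I_minus_kron F G \<in> carrier_mat (n * n) (n * n)"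
  by (auto simp: I_minus_kron_def kron_def)

lemma vec_of_mat_carrier: "X \<in> carrier_mat n n \<Longrightarrow> vec_of_mat X \<in> carrier_vec (n * n)"
  by (auto simp: vec_of_mat_def)

lemma mat_of_vec_carrier [simp]: "mat_of_vec n x \<in> carrier_mat n n"
  by (simp add: mat_of_vec_def)

lemma vec_of_mat_index:
  "X \<in> carrier_mat n n \<Longrightarrow> k < n * n \<Longrightarrow> vec_of_mat X $ k = X $$ (k mod n, k div n)"
  by (auto simp: vec_of_mat_def)

text \<open>Column stacking stores the column in the quotient and the row in the remainder, so the
  first Kronecker factor acts on columns and the second on rows.\<close>

lemma kron_mult_vec:
  fixes F G X :: "'a :: comm_ring_1 mat"
  assumes F: "F \<in> carrier_mat n n" and G: "G \<in> carrier_mat n n" and X: "X \<in> carrier_mat n n"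
  shows "kron F G *\<^sub>v vec_of_mat X = vec_of_mat (G * X * transpose_mat F)"
proof (rule eq_vecI)
  have car: "G * X * transpose_mat F \<in> carrier_mat n n" using assms by auto
  show "dim_vec (kron F G *\<^sub>v vec_of_mat X) = dim_vec (vec_of_mat (G * X * transpose_mat F))"
    using assms by (auto simp: kron_def vec_of_mat_def)
  fix k assume "k < dim_vec (vec_of_mat (G * X * transpose_mat F))"
  then have k: "k < n * n" using carrier_matD[OF car] by (simp add: vec_of_mat_def)
  then have n: "0 < n" by (cases n) auto
  from k n have kn: "k mod n < n" "k div n < n" by (auto simp: less_mult_imp_div_less)
  have "(kron F G *\<^sub>v vec_of_mat X) $ k
      = (\<Sum>j<n * n. F $$ (k div n, j div n) * G $$ (k mod n, j mod n) * X $$ (j mod n, j div n))"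
    using k assms by (auto simp: kron_def scalar_prod_def vec_of_mat_def atLeast0LessThan)
  also have "\<dots> = (\<Sum>l<n. \<Sum>i<n. F $$ (k div n, l) * G $$ (k mod n, i) * X $$ (i, l))"
    by (rule sum_div_mod[where f = "\<lambda>l i. F $$ (k div n, l) * G $$ (k mod n, i) * X $$ (i, l)"])
  also have "\<dots> = (G * X * transpose_mat F) $$ (k mod n, k div n)"
    using assms kn
    by (subst sum.swap) (auto simp: scalar_prod_def atLeast0LessThan sum_distrib_left sum_distrib_right mult_ac
        intro!: sum.cong)
  also have "\<dots> = vec_of_mat (G * X * transpose_mat F) $ k"
    using vec_of_mat_index[OF car k] by simp
  finally show "(kron F G *\<^sub>v vec_of_mat X) $ k = vec_of_mat (G * X * transpose_mat F) $ k" .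
qed

lemma I_minus_kron_mult_vec:
  fixes F G X :: "'a :: comm_ring_1 mat"
  assumes F: "F \<in> carrier_mat n n" and G: "G \<in> carrier_mat n n" and X: "X \<in> carrier_mat n n"
  shows "I_minus_kron F G *\<^sub>v vec_of_mat X = vec_of_mat (X - G * X * transpose_mat F)"
proof -
  have "I_minus_kron F G *\<^sub>v vec_of_mat X = vec_of_mat X - vec_of_mat (G * X * transpose_mat F)"
    using assms vec_of_mat_carrier[OF X]
    by (simp add: I_minus_kron_def kron_mult_vec minus_mult_distrib_mat_vec[OF one_carrier_mat kron_carrier])
  also have "\<dots> = vec_of_mat (X - G * X * transpose_mat F)"
  proof (rule eq_vecI)
    fix k assume "k < dim_vec (vec_of_mat (X - G * X * transpose_mat F))"
    then have k: "k < n * n" using assms by (auto simp: vec_of_mat_def)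
    then have "0 < n" by (cases n) auto
    with k have "k mod n < n" "k div n < n" by (auto simp: less_mult_imp_div_less)
    then show "(vec_of_mat X - vec_of_mat (G * X * transpose_mat F)) $ k = vec_of_mat (X - G * X * transpose_mat F) $ k"
      using k assms by (auto simp: vec_of_mat_def simp del: index_mult_mat(1))
  qed (use assms in \<open>auto simp: vec_of_mat_def\<close>)
  finally show ?thesis .
qed

text \<open>Transposition preserves determinants, so a nonzero \<open>delta_P\<close> also yields
  uniqueness for the equation with A^T in place of \<open>A\<close>.\<close>

lemma I_minus_kron_transpose:
  assumes "F \<in> carrier_mat n n" "G \<in> carrier_mat n n"
  shows "I_minus_kron (transpose_mat F) (transpose_mat G) = transpose_mat (I_minus_kron F G)"
proof (rule eq_matI)
  fix i j assume "i < dim_row (transpose_mat (I_minus_kron F G))" "j < dim_col (transpose_mat (I_minus_kron F G))"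
  then have ij: "i < n * n" "j < n * n" using assms by (auto simp: I_minus_kron_def kron_def)
  then have "0 < n" by (cases n) auto
  with ij show "I_minus_kron (transpose_mat F) (transpose_mat G) $$ (i, j) = transpose_mat (I_minus_kron F G) $$ (i, j)"
    using assms by (auto simp: I_minus_kron_def kron_def less_mult_imp_div_less)
qed (use assms in \<open>auto simp: I_minus_kron_def kron_def\<close>)

text \<open>Cramer's numerator for X = G X F^T + Y, the common shape of the three hat
  matrices.\<close>

definition sylvester_adj :: "nat \<Rightarrow> 'a :: comm_ring_1 mat \<Rightarrow> 'a mat \<Rightarrow> 'a mat \<Rightarrow> 'a mat" where
  "sylvester_adj n F G Y = mat_of_vec n (adj_mat (I_minus_kron F G) *\<^sub>v vec_of_mat Y)"

lemma vec_of_mat_inj: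
  "vec_of_mat X = vec_of_mat Y \<Longrightarrow> X \<in> carrier_mat n n \<Longrightarrow> Y \<in> carrier_mat n n \<Longrightarrow> X = Y"
  by (metis mat_of_vec_of_mat)

lemma vec_of_mat_smult: "vec_of_mat (a \<cdot>\<^sub>m X) = a \<cdot>\<^sub>v vec_of_mat X" if "X \<in> carrier_mat n n"
proof (rule eq_vecI)
  fix k assume "k < dim_vec (a \<cdot>\<^sub>v vec_of_mat X)"
  then have k: "k < n * n" using that by (auto simp: vec_of_mat_def)
  then have "0 < n" by (cases n) auto
  with k show "vec_of_mat (a \<cdot>\<^sub>m X) $ k = (a \<cdot>\<^sub>v vec_of_mat X) $ k"
    using that by (auto simp: vec_of_mat_def less_mult_imp_div_less)
qed (use that in \<open>auto simp: vec_of_mat_def\<close>)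

lemma vec_of_mat_zero: "vec_of_mat (0\<^sub>m n n) = 0\<^sub>v (n * n)"
proof (rule eq_vecI)
  fix k assume "k < dim_vec (0\<^sub>v (n * n))"
  then have k: "k < n * n" by simp
  then have "0 < n" by (cases n) auto
  with k show "vec_of_mat (0\<^sub>m n n) $ k = 0\<^sub>v (n * n) $ k"
    by (auto simp: vec_of_mat_def less_mult_imp_div_less)
qed (auto simp: vec_of_mat_def)

lemma smult_one_mult_vec: "x \<in> carrier_vec m \<Longrightarrow> (a \<cdot>\<^sub>m 1\<^sub>m m) *\<^sub>v x = a \<cdot>\<^sub>v x"
  for a :: "'a :: comm_ring_1"
  by (intro eq_vecI) auto

lemma sylvester_adj:
  fixes F G Y :: "'a :: comm_ring_1 mat"
  assumes F: "F \<in> carrier_mat n n" and G: "G \<in> carrier_mat n n" and Y: "Y \<in> carrier_mat n n"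
  defines "X \<equiv> sylvester_adj n F G Y"
  shows "X \<in> carrier_mat n n" "X - G * X * transpose_mat F = det (I_minus_kron F G) \<cdot>\<^sub>m Y"
proof -
  note M = I_minus_kron_carrier[OF F G]
  note adj = adj_mat[OF M] and y = vec_of_mat_carrier[OF Y]
  show X: "X \<in> carrier_mat n n" by (simp add: X_def sylvester_adj_def)
  have vX: "vec_of_mat X = adj_mat (I_minus_kron F G) *\<^sub>v vec_of_mat Y"
    unfolding X_def sylvester_adj_def by (rule vec_of_mat_of_vec) (rule mult_mat_vec_carrier[OF adj(1) y])
  have "vec_of_mat (X - G * X * transpose_mat F) = (I_minus_kron F G * adj_mat (I_minus_kron F G)) *\<^sub>v vec_of_mat Y"
    unfolding I_minus_kron_mult_vec[OF F G X, symmetric] vX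
    by (rule assoc_mult_mat_vec[OF M adj(1) y, symmetric])
  also have "\<dots> = vec_of_mat (det (I_minus_kron F G) \<cdot>\<^sub>m Y)"
    unfolding adj(2) vec_of_mat_smult[OF Y] using y by (intro eq_vecI) auto
  finally show "X - G * X * transpose_mat F = det (I_minus_kron F G) \<cdot>\<^sub>m Y"
    by (rule vec_of_mat_inj[of _ _ n]) (use X F G Y in \<open>auto simp: minus_carrier_mat\<close>)
qed

lemma sylvester_unique:
  fixes F G X :: "'a :: field mat"
  assumes F: "F \<in> carrier_mat n n" and G: "G \<in> carrier_mat n n" and X: "X \<in> carrier_mat n n"
    and det: "det (I_minus_kron F G) \<noteq> 0" and eq: "X = G * X * transpose_mat F"
  shows "X = 0\<^sub>m n n"
proof -
  note M = I_minus_kron_carrier[OF F G] and x = vec_of_mat_carrier[OF X]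
  note adj = adj_mat[OF M]
  have "X - G * X * transpose_mat F = 0\<^sub>m n n"
    unfolding eq[symmetric] using X by auto
  then have "I_minus_kron F G *\<^sub>v vec_of_mat X = 0\<^sub>v (n * n)"
    by (simp add: I_minus_kron_mult_vec[OF F G X] vec_of_mat_zero)
  then have "adj_mat (I_minus_kron F G) *\<^sub>v (I_minus_kron F G *\<^sub>v vec_of_mat X) = 0\<^sub>v (n * n)"
    using adj(1) by auto
  then have "det (I_minus_kron F G) \<cdot>\<^sub>v vec_of_mat X = 0\<^sub>v (n * n)"
    unfolding assoc_mult_mat_vec[OF adj(1) M x, symmetric] adj(3) using x
    by (metis smult_one_mult_vec)
  then have "det (I_minus_kron F G) * vec_of_mat X $ k = 0" if "k < n * n" for k
    using that x by (metis carrier_vecD index_smult_vec(1) index_zero_vec(1))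
  then have "vec_of_mat X = vec_of_mat (0\<^sub>m n n)"
    using det x by (intro eq_vecI) (auto simp: vec_of_mat_zero)
  then show ?thesis by (rule vec_of_mat_inj[OF _ X]) simp
qed

section \<open>Naturality under ring homomorphisms\<close>

context comm_ring_hom begin

lemma hom_adj_mat: "mat\<^sub>h (adj_mat M) = adj_mat (mat\<^sub>h M)"
proof (rule eq_matI)
  fix i j assume "i < dim_row (adj_mat (mat\<^sub>h M))" "j < dim_col (adj_mat (mat\<^sub>h M))"
  then have ij: "i < dim_row M" "j < dim_col M" by (auto simp: adj_mat_def)
  have "mat\<^sub>h (mat_delete M j i) = mat_delete (mat\<^sub>h M) j i"
    by (rule eq_matI) (auto simp: mat_delete_def)
  then show "mat\<^sub>h (adj_mat M) $$ (i, j) = adj_mat (mat\<^sub>h M) $$ (i, j)"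
    using ij by (simp add: adj_mat_def cofactor_def hom_distribs flip: hom_det)
qed (auto simp: adj_mat_def)

lemma mat_hom_add: "dim_row M = dim_row N \<Longrightarrow> dim_col M = dim_col N \<Longrightarrow> mat\<^sub>h (M + N) = mat\<^sub>h M + mat\<^sub>h N"
  by (rule eq_matI) (auto simp: hom_distribs)

lemma mat_hom_diff: "dim_row M = dim_row N \<Longrightarrow> dim_col M = dim_col N \<Longrightarrow> mat\<^sub>h (M - N) = mat\<^sub>h M - mat\<^sub>h N"
  by (rule eq_matI) (auto simp: hom_distribs)

lemma mat_hom_smult: "mat\<^sub>h (a \<cdot>\<^sub>m M) = hom a \<cdot>\<^sub>m mat\<^sub>h M"
  by (rule eq_matI) (auto simp: hom_distribs)

lemma mat_hom_transpose: "mat\<^sub>h (transpose_mat M) = transpose_mat (mat\<^sub>h M)"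
  by (rule eq_matI) auto

lemma mat_hom_outer: "mat\<^sub>h (outer v w) = outer (vec\<^sub>h v) (vec\<^sub>h w)"
  by (rule eq_matI) (auto simp: outer_def hom_distribs)

lemma mat_hom_A2:
  "A \<in> carrier_mat n n \<Longrightarrow> v \<in> carrier_vec n \<Longrightarrow> w \<in> carrier_vec n \<Longrightarrow>
    mat\<^sub>h (A2 A v w) = A2 (mat\<^sub>h A) (vec\<^sub>h v) (vec\<^sub>h w)"
  by (auto simp: A2_def mat_hom_add mat_hom_outer)

lemma mat_hom_I_minus_kron:
  assumes "F \<in> carrier_mat n n" "G \<in> carrier_mat n n"
  shows "mat\<^sub>h (I_minus_kron F G) = I_minus_kron (mat\<^sub>h F) (mat\<^sub>h G)"
proof -
  have "mat\<^sub>h (kron F G) = kron (mat\<^sub>h F) (mat\<^sub>h G)"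
  proof (rule eq_matI)
    fix i j assume "i < dim_row (kron (mat\<^sub>h F) (mat\<^sub>h G))" "j < dim_col (kron (mat\<^sub>h F) (mat\<^sub>h G))"
    then have ij: "i < n * n" "j < n * n" using assms by (auto simp: kron_def)
    then have "0 < n" by (cases n) auto
    with ij show "mat\<^sub>h (kron F G) $$ (i, j) = kron (mat\<^sub>h F) (mat\<^sub>h G) $$ (i, j)"
      using assms by (auto simp: kron_def less_mult_imp_div_less hom_distribs)
  qed (auto simp: kron_def)
  then show ?thesis
    using assms by (simp add: I_minus_kron_def mat_hom_diff mat_hom_one kron_def)
qed

lemma mat_hom_sylvester_adj:
  assumes "F \<in> carrier_mat n n" "G \<in> carrier_mat n n" "Y \<in> carrier_mat n n"
  shows "mat\<^sub>h (sylvester_adj n F G Y) = sylvester_adj n (mat\<^sub>h F) (mat\<^sub>h G) (mat\<^sub>h Y)"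
proof -
  note adj = adj_mat(1)[OF I_minus_kron_carrier[OF assms(1,2)]] and y = vec_of_mat_carrier[OF assms(3)]
  have vec: "vec\<^sub>h (vec_of_mat Y) = vec_of_mat (mat\<^sub>h Y)"
  proof (rule eq_vecI)
    fix k assume "k < dim_vec (vec_of_mat (mat\<^sub>h Y))"
    then have k: "k < n * n" using assms by (auto simp: vec_of_mat_def)
    then have "0 < n" by (cases n) auto
    with k show "vec\<^sub>h (vec_of_mat Y) $ k = vec_of_mat (mat\<^sub>h Y) $ k"
      using assms by (auto simp: vec_of_mat_def less_mult_imp_div_less)
  qed (auto simp: vec_of_mat_def)
  have mat: "mat\<^sub>h (mat_of_vec n x) = mat_of_vec n (vec\<^sub>h x)" if "x \<in> carrier_vec (n * n)" for x
  proof (rule eq_matI)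
    fix i j assume "i < dim_row (mat_of_vec n (vec\<^sub>h x))" "j < dim_col (mat_of_vec n (vec\<^sub>h x))"
    then have ij: "i < n" "j < n" by (auto simp: mat_of_vec_def)
    then have "j * n + i < (j + 1) * n" by simp
    also have "\<dots> \<le> n * n" using ij by (intro mult_right_mono) auto
    finally show "mat\<^sub>h (mat_of_vec n x) $$ (i, j) = mat_of_vec n (vec\<^sub>h x) $$ (i, j)"
      using ij that by (auto simp: mat_of_vec_def)
  qed (auto simp: mat_of_vec_def)
  show ?thesis
    unfolding sylvester_adj_def mat[OF mult_mat_vec_carrier[OF adj y]] mult_mat_vec_hom[OF adj y]
      vec hom_adj_mat mat_hom_I_minus_kron[OF assms(1,2)] ..
qed

context
  fixes A :: "'a mat" and v w :: "'a vec" and n :: nat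
  assumes A: "A \<in> carrier_mat n n" and v: "v \<in> carrier_vec n" and w: "w \<in> carrier_vec n"
begin

lemma A2_carrier: "A2 A v w \<in> carrier_mat n n"
  using A v w by (simp add: A2_def)

lemma dim_hats: "dim_row A = n" "dim_row (mat\<^sub>h A) = n"
  using A by auto

lemma hom_delta_P: "hom (delta_P A) = delta_P (mat\<^sub>h A)"
  unfolding delta_P_def hom_det[symmetric] mat_hom_I_minus_kron[OF A A] ..

lemma hom_delta_Q: "hom (delta_Q A v w) = delta_Q (mat\<^sub>h A) (vec\<^sub>h v) (vec\<^sub>h w)"
  using A2_carrier A v w
  by (simp add: delta_Q_def mat_hom_I_minus_kron[of _ n] mat_hom_transpose mat_hom_A2 flip: hom_det)

lemma hom_delta_R: "hom (delta_R A v w) = delta_R (mat\<^sub>h A) (vec\<^sub>h v) (vec\<^sub>h w)"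
  using A2_carrier A v w
  by (simp add: delta_R_def mat_hom_I_minus_kron[of _ n] mat_hom_transpose mat_hom_A2 flip: hom_det)

lemma hom_P_hat: "mat\<^sub>h (P_hat A v) = P_hat (mat\<^sub>h A) (vec\<^sub>h v)"
  using A v by (simp add: P_hat_def dim_hats mat_hom_sylvester_adj mat_hom_outer flip: sylvester_adj_def)

lemma hom_Q_hat: "mat\<^sub>h (Q_hat A v w) = Q_hat (mat\<^sub>h A) (vec\<^sub>h v) (vec\<^sub>h w)"
  using A v w A2_carrier
  by (simp add: Q_hat_def dim_hats mat_hom_sylvester_adj mat_hom_outer mat_hom_transpose mat_hom_A2 flip: sylvester_adj_def)

lemma hom_R_hat: "mat\<^sub>h (R_hat A v w) = R_hat (mat\<^sub>h A) (vec\<^sub>h v) (vec\<^sub>h w)"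
  using A v w A2_carrier
  by (simp add: R_hat_def dim_hats mat_hom_sylvester_adj mat_hom_outer mat_hom_transpose mat_hom_A2 flip: sylvester_adj_def)

lemma hat_carriers:
  "P_hat A v \<in> carrier_mat n n" "Q_hat A v w \<in> carrier_mat n n" "R_hat A v w \<in> carrier_mat n n"
  by (simp_all add: P_hat_def Q_hat_def R_hat_def dim_hats)

lemma hom_N_hat: "mat\<^sub>h (N_hat A v w) = N_hat (mat\<^sub>h A) (vec\<^sub>h v) (vec\<^sub>h w)"
  unfolding N_hat_def dim_hats
  using hat_carriers
  by (simp add: mat_hom_add mat_hom_smult mat_hom_one mat_hom_mult[of _ n n _ n] hom_P_hat hom_Q_hat
      hom_mult hom_delta_P hom_delta_Q)

lemma hom_krylov: "mat\<^sub>h (krylov A v) = krylov (mat\<^sub>h A) (vec\<^sub>h v)"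
proof (rule eq_matI)
  fix i j assume ij: "i < dim_row (krylov (mat\<^sub>h A) (vec\<^sub>h v))" "j < dim_col (krylov (mat\<^sub>h A) (vec\<^sub>h v))"
  have "vec\<^sub>h (A ^\<^sub>m j *\<^sub>v v) = mat\<^sub>h A ^\<^sub>m j *\<^sub>v vec\<^sub>h v"
    using mult_mat_vec_hom[OF pow_carrier_mat[OF A, of j] v] by (simp add: mat_hom_pow[OF A])
  then show "mat\<^sub>h (krylov A v) $$ (i, j) = krylov (mat\<^sub>h A) (vec\<^sub>h v) $$ (i, j)"
    using ij A pow_carrier_mat[OF A, of j]
    by (auto simp: krylov_def dest!: arg_cong[of _ _ "\<lambda>x. x $ i"])
qed (auto simp: krylov_def)

lemma map_poly_pCons: "map_poly hom (pCons a p) = pCons (hom a) (map_poly hom p)"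
  by (rule poly_eqI) (auto simp: coeff_map_poly coeff_pCons split: nat.split)

lemma map_poly_smult_hom: "map_poly hom (Polynomial.smult a p) = Polynomial.smult (hom a) (map_poly hom p)"
  by (rule poly_eqI) (auto simp: coeff_map_poly hom_distribs)

lemma mat_hom_const_mat: "map_mat (map_poly hom) (const_mat M) = const_mat (mat\<^sub>h M)"
  by (rule eq_matI) (auto simp: const_mat_def map_poly_pCons)

interpretation map_poly_hom: map_poly_comm_ring_hom hom ..

text \<open>Everything is built by ring operations, and \<open>hom\<close> acts on coefficients
  while \<open>lam\<close> stays fixed. Two homomorphisms are of interest: evaluation at a point of
  a parametrized line, and substitution of reals for the indeterminates.\<close>

lemma hom_hat_lhs: "map_poly hom (hat_lhs A v w) = hat_lhs (mat\<^sub>h A) (vec\<^sub>h v) (vec\<^sub>h w)"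
proof -
  note c = hat_carriers
  have c': "R_hat A v w * adj_mat (Q_hat A v w) * transpose_mat (R_hat A v w) \<in> carrier_mat n n"
    using c adj_mat(1)[OF c(2)] by auto
  have 1: "mat\<^sub>h (R_hat A v w * adj_mat (Q_hat A v w) * transpose_mat (R_hat A v w))
    = R_hat (mat\<^sub>h A) (vec\<^sub>h v) (vec\<^sub>h w) * adj_mat (Q_hat (mat\<^sub>h A) (vec\<^sub>h v) (vec\<^sub>h w)) *
      transpose_mat (R_hat (mat\<^sub>h A) (vec\<^sub>h v) (vec\<^sub>h w))"
    using c adj_mat(1)[OF c(2)]
    by (simp add: mat_hom_mult[of _ n n _ n] sq_carrier[of _ n] hom_adj_mat mat_hom_transpose hom_Q_hat hom_R_hat
        del: assoc_mult_mat)
  show ?thesis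
    unfolding hat_lhs_def Let_def
    using c c'
    by (simp add: map_poly_hom.hom_mult map_poly_hom.mat_hom_diff map_poly_hom.mat_hom_smult
        mat_hom_const_mat mat_hom_smult 1 hom_P_hat hom_Q_hat hom_N_hat hom_delta_P hom_delta_Q hom_delta_R
        hom_mult hom_power map_poly_pCons map_poly_smult_hom
        flip: hom_det map_poly_hom.hom_det)
qed

lemma hom_hat_rhs: "map_poly hom (hat_rhs A v w) = hat_rhs (mat\<^sub>h A) (vec\<^sub>h v) (vec\<^sub>h w)"
proof -
  note c = hat_carriers
  show ?thesis
    unfolding hat_rhs_def Let_def dim_hats
    using c
    by (simp add: map_poly_hom.hom_mult map_poly_hom.mat_hom_add map_poly_hom.mat_hom_smult map_poly_hom.mat_hom_one
        mat_hom_const_mat mat_hom_mult[of _ n n _ n] hom_P_hat hom_Q_hat hom_delta_P hom_delta_Q hom_delta_R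
        hom_mult hom_power map_poly_pCons map_poly_smult_hom map_poly_hom.hom_minus
        flip: hom_det map_poly_hom.hom_det)
qed

end
end

section \<open>Evaluation of parameter polynomials\<close>

text \<open>Evaluation at an arbitrary assignment of the indeterminates, of which
  \<open>eval_at\<close> is the instance \<open>indet_val A v w\<close>. Quantifying over all
  assignments is what the vanishing criterion requires.\<close>

definition insertion :: "(indet \<Rightarrow> real) \<Rightarrow> param_poly \<Rightarrow> real" where
  "insertion \<sigma> p = (\<Sum>m\<in>Poly_Mapping.keys p. Poly_Mapping.lookup p m *
     (\<Prod>x\<in>Poly_Mapping.keys m. \<sigma> x ^ Poly_Mapping.lookup m x))"

abbreviation monomial_value :: "(indet \<Rightarrow> real) \<Rightarrow> (indet \<Rightarrow>\<^sub>0 nat) \<Rightarrow> real" where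
  "monomial_value \<sigma> m \<equiv> (\<Prod>x\<in>Poly_Mapping.keys m. \<sigma> x ^ Poly_Mapping.lookup m x)"

lemma monomial_value_superset:
  assumes "finite V" "Poly_Mapping.keys m \<subseteq> V"
  shows "monomial_value \<sigma> m = (\<Prod>x\<in>V. \<sigma> x ^ Poly_Mapping.lookup m x)"
  using assms by (intro prod.mono_neutral_left) (auto simp: in_keys_iff)

lemma monomial_value_add: "monomial_value \<sigma> (m + m') = monomial_value \<sigma> m * monomial_value \<sigma> m'"
proof -
  let ?V = "Poly_Mapping.keys m \<union> Poly_Mapping.keys m'"
  have "monomial_value \<sigma> (m + m') = (\<Prod>x\<in>?V. \<sigma> x ^ Poly_Mapping.lookup (m + m') x)"
    using keys_add[of m m'] by (intro monomial_value_superset) auto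
  also have "\<dots> = (\<Prod>x\<in>?V. \<sigma> x ^ Poly_Mapping.lookup m x) * (\<Prod>x\<in>?V. \<sigma> x ^ Poly_Mapping.lookup m' x)"
    by (simp add: lookup_add power_add prod.distrib)
  also have "\<dots> = monomial_value \<sigma> m * monomial_value \<sigma> m'"
    by (simp add: monomial_value_superset[of ?V])
  finally show ?thesis .
qed

lemma insertion_superset:
  assumes "finite M" "Poly_Mapping.keys p \<subseteq> M"
  shows "insertion \<sigma> p = (\<Sum>m\<in>M. Poly_Mapping.lookup p m * monomial_value \<sigma> m)"
  unfolding insertion_def using assms by (intro sum.mono_neutral_left) (auto simp: in_keys_iff)

lemma insertion_add: "insertion \<sigma> (p + q) = insertion \<sigma> p + insertion \<sigma> q"
proof -
  let ?M = "Poly_Mapping.keys p \<union> Poly_Mapping.keys q"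
  have "insertion \<sigma> (p + q) = (\<Sum>m\<in>?M. Poly_Mapping.lookup (p + q) m * monomial_value \<sigma> m)"
    using keys_add[of p q] by (intro insertion_superset) auto
  also have "\<dots> = insertion \<sigma> p + insertion \<sigma> q"
    by (simp add: insertion_superset[of ?M] lookup_add distrib_right sum.distrib)
  finally show ?thesis .
qed

lemma insertion_single: "insertion \<sigma> (Poly_Mapping.single m a) = a * monomial_value \<sigma> m"
  by (cases "a = 0") (simp_all add: insertion_def)

text \<open>Every finitely supported function is the finite sum of its single terms, so
  multiplicativity of evaluation reduces to monomials.\<close>

lemma poly_mapping_single_induct [case_names single sum]:
  fixes p :: "'a \<Rightarrow>\<^sub>0 'b :: comm_monoid_add"
  assumes single: "\<And>m a. Q (Poly_Mapping.single m a)" and sum: "\<And>p q. Q p \<Longrightarrow> Q q \<Longrightarrow> Q (p + q)"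
  shows "Q p"
proof -
  have "Q (\<Sum>m\<in>M. Poly_Mapping.single m (Poly_Mapping.lookup p m))" if "finite M" for M
    using that
  proof (induction M rule: finite_induct)
    case empty
    \<comment> \<open>The empty sum is a single term with coefficient 0 at an arbitrary key.\<close>
    then show ?case using single[of undefined 0] by simp
  qed (simp add: single sum)
  moreover have "p = (\<Sum>m\<in>Poly_Mapping.keys p. Poly_Mapping.single m (Poly_Mapping.lookup p m))"
    by (rule poly_mapping_eqI) (auto simp: lookup_sum lookup_single when_def in_keys_iff)
  ultimately show ?thesis by (metis finite_keys)
qed

lemma insertion_mult_single:
  "insertion \<sigma> (Poly_Mapping.single m a * q) = a * monomial_value \<sigma> m * insertion \<sigma> q"
proof (induction q rule: poly_mapping_single_induct)
  case (single m' b)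
  then show ?case by (simp add: mult_single insertion_single monomial_value_add)
next
  case (sum p q)
  then show ?case by (simp add: distrib_left insertion_add)
qed

lemma insertion_mult: "insertion \<sigma> (p * q) = insertion \<sigma> p * insertion \<sigma> q"
proof (induction p rule: poly_mapping_single_induct)
  case (single m a)
  then show ?case by (simp add: insertion_mult_single insertion_single)
next
  case (sum p p')
  then show ?case by (simp add: distrib_right insertion_add)
qed

lemma insertion_hom: "comm_ring_hom (insertion \<sigma>)"
proof
  show "insertion \<sigma> 1 = 1"
    using insertion_single[of \<sigma> 0 1] by (simp add: single_one)
  show "insertion \<sigma> 0 = 0" by (simp add: insertion_def)
qed (simp_all add: insertion_add insertion_mult)

text \<open>Induction on the set of variables, splitting off one variable \<open>y\<close>. The
  separation hypothesis on \<open>K\<close> survives: inside \<open>Ky k\<close> the exponent of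
  \<open>y\<close> is constant, so the remaining variables still tell the exponent functions
  apart.\<close>

lemma coefficients_zero_if_vanishing:
  fixes c :: "('x \<Rightarrow> nat) \<Rightarrow> real"
  assumes "finite V" "finite K"
    and "\<And>m m'. m \<in> K \<Longrightarrow> m' \<in> K \<Longrightarrow> (\<And>x. x \<in> V \<Longrightarrow> m x = m' x) \<Longrightarrow> m = m'"
    and "\<And>\<sigma>. (\<Sum>m\<in>K. c m * (\<Prod>x\<in>V. \<sigma> x ^ m x)) = 0"
    and "m \<in> K"
  shows "c m = 0"
  using assms
proof (induction V arbitrary: K m rule: finite_induct)
  case empty
  then have "K = {m}" by auto
  then show ?case using empty by simp
next
  case (insert y V)
  define Ky where "Ky k = {m' \<in> K. m' y = k}" for k
  have vanish: "(\<Sum>m\<in>Ky k. c m * (\<Prod>x\<in>V. \<sigma> x ^ m x)) = 0" for k and \<sigma> :: "'x \<Rightarrow> real"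
  proof -
    \<comment> \<open>The sum as a polynomial in the value t of \<open>y\<close>, the other
      variables being frozen. It vanishes at all reals, so its coefficient at each k, which is the
      sum over \<open>Ky k\<close>, is zero.\<close>
    let ?p = "\<Sum>m\<in>K. monom (c m * (\<Prod>x\<in>V. \<sigma> x ^ m x)) (m y)"
    have "poly ?p t = 0" for t
    proof -
      have "poly ?p t = (\<Sum>m\<in>K. c m * (\<Prod>x\<in>insert y V. (\<sigma>(y := t)) x ^ m x))"
        unfolding poly_sum poly_monom
      proof (rule sum.cong[OF refl])
        fix m
        have "(\<Prod>x\<in>V. (\<sigma>(y := t)) x ^ m x) = (\<Prod>x\<in>V. \<sigma> x ^ m x)"
          using insert.hyps by (intro prod.cong) auto
        then show "c m * (\<Prod>x\<in>V. \<sigma> x ^ m x) * t ^ m y = c m * (\<Prod>x\<in>insert y V. (\<sigma>(y := t)) x ^ m x)"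
          using insert.hyps by simp
      qed
      then show ?thesis using insert.prems(3) by simp
    qed
    then have "?p = 0" by (intro iffD1[OF poly_all_0_iff_0] allI)
    then have "coeff ?p k = 0" by simp
    moreover have "coeff ?p k = (\<Sum>m\<in>K. if m y = k then c m * (\<Prod>x\<in>V. \<sigma> x ^ m x) else 0)"
      unfolding coeff_sum coeff_monom ..
    moreover have "\<dots> = (\<Sum>m\<in>Ky k. c m * (\<Prod>x\<in>V. \<sigma> x ^ m x))"
      unfolding Ky_def by (rule sum.inter_filter[OF insert.prems(1), symmetric])
    ultimately show ?thesis by simp
  qed
  show ?case
  proof (rule insert.IH[of "Ky (m y)"])
    show "m1 = m2" if "m1 \<in> Ky (m y)" "m2 \<in> Ky (m y)" "\<And>x. x \<in> V \<Longrightarrow> m1 x = m2 x" for m1 m2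
      using that by (intro insert.prems(2)) (auto simp: Ky_def)
  qed (use insert.prems vanish in \<open>auto simp: Ky_def\<close>)
qed

lemma param_poly_eq_zero:
  assumes "\<And>\<sigma>. insertion \<sigma> p = 0"
  shows "p = 0"
proof (rule ccontr)
  assume "p \<noteq> 0"
  then obtain m where m: "m \<in> Poly_Mapping.keys p" by fastforce
  define V where "V = (\<Union>m\<in>Poly_Mapping.keys p. Poly_Mapping.keys m)"
  have V: "finite V" "\<And>m. m \<in> Poly_Mapping.keys p \<Longrightarrow> Poly_Mapping.keys m \<subseteq> V" by (auto simp: V_def)
  let ?K = "Poly_Mapping.lookup ` Poly_Mapping.keys p"
  have inj: "inj_on Poly_Mapping.lookup (Poly_Mapping.keys p)"
    by (simp add: inj_on_def lookup_inject)
  \<comment> \<open>Coefficients are reindexed by plain exponent functions; on \<open>?K\<close>,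
    \<open>Abs_poly_mapping\<close> recovers the monomial from its \<open>lookup\<close>.\<close>
  let ?c = "\<lambda>f. Poly_Mapping.lookup p (Abs_poly_mapping f)"
  have "?c (Poly_Mapping.lookup m) = 0"
  proof (rule coefficients_zero_if_vanishing[of V ?K])
    fix f g assume "f \<in> ?K" "g \<in> ?K" and eq: "\<And>x. x \<in> V \<Longrightarrow> f x = g x"
    then obtain a b where ab: "a \<in> Poly_Mapping.keys p" "b \<in> Poly_Mapping.keys p" "f = Poly_Mapping.lookup a" "g = Poly_Mapping.lookup b"
      by auto
    show "f = g"
    proof
      fix x show "f x = g x"
      proof (cases "x \<in> V")
        case False
        then have "x \<notin> Poly_Mapping.keys a" "x \<notin> Poly_Mapping.keys b" using V(2) ab by blast+
        then show ?thesis using ab by (simp add: in_keys_iff)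
      qed (rule eq)
    qed
  next
    fix \<sigma> :: "indet \<Rightarrow> real"
    have "(\<Sum>f\<in>?K. ?c f * (\<Prod>x\<in>V. \<sigma> x ^ f x)) = insertion \<sigma> p"
      unfolding insertion_def using V
      by (simp add: sum.reindex[OF inj] lookup_inverse monomial_value_superset[of V])
    then show "(\<Sum>f\<in>?K. ?c f * (\<Prod>x\<in>V. \<sigma> x ^ f x)) = 0" using assms by simp
  qed (use V m in auto)
  then show False using m by (simp add: lookup_inverse in_keys_iff)
qed

section \<open>A generic point\<close>

text \<open>The product of all quantities whose nonvanishing \<open>gramians\<close> relies on; as a
  single polynomial it calls for a single witness. \<open>P_hat\<close> replaces \<open>P\<close>
  because \<open>P\<close> itself is only a rational function of the parameters.\<close>

definition generic_point :: "'a :: comm_ring_1 mat \<Rightarrow> 'a vec \<Rightarrow> 'a vec \<Rightarrow> 'a" where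
  "generic_point A v w = delta_P A * delta_Q A v w * delta_R A v w * det (P_hat A v) * det A *
     det (krylov A v) * det (krylov (transpose_mat (A2 A v w)) w)"

text \<open>Converse of \<open>sylvester_unique\<close>: a kernel vector, reshaped to a square
  matrix, is a nonzero homogeneous solution.\<close>

lemma det_I_minus_kron_nonzero:
  fixes F G :: "'a :: field mat"
  assumes F: "F \<in> carrier_mat n n" and G: "G \<in> carrier_mat n n"
    and uniq: "\<And>X. X \<in> carrier_mat n n \<Longrightarrow> X = G * X * transpose_mat F \<Longrightarrow> X = 0\<^sub>m n n"
  shows "det (I_minus_kron F G) \<noteq> 0"
proof
  assume "det (I_minus_kron F G) = 0"
  then obtain x where x: "x \<in> carrier_vec (n * n)" "x \<noteq> 0\<^sub>v (n * n)" "I_minus_kron F G *\<^sub>v x = 0\<^sub>v (n * n)"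
    using det_0_iff_vec_prod_zero[OF I_minus_kron_carrier[OF F G]] by auto
  define X where "X = mat_of_vec n x"
  have X: "X \<in> carrier_mat n n" by (simp add: X_def)
  have vX: "vec_of_mat X = x" unfolding X_def by (rule vec_of_mat_of_vec[OF x(1)])
  have "vec_of_mat (X - G * X * transpose_mat F) = vec_of_mat (0\<^sub>m n n)"
    unfolding I_minus_kron_mult_vec[OF F G X, symmetric] vX x(3) vec_of_mat_zero ..
  then have diff: "X - G * X * transpose_mat F = 0\<^sub>m n n"
    by (rule vec_of_mat_inj[of _ _ n]) (use X F G in \<open>auto simp: minus_carrier_mat\<close>)
  have "X = G * X * transpose_mat F"
  proof (rule mat_eqI[of _ n])
    fix i j assume "i < n" "j < n"
    then show "X $$ (i, j) = (G * X * transpose_mat F) $$ (i, j)"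
      using arg_cong[OF diff, of "\<lambda>M. M $$ (i, j)"] X F G by (simp del: index_mult_mat(1))
  qed (use X F G in auto)
  then have "X = 0\<^sub>m n n" by (rule uniq[OF X])
  then have "x = 0\<^sub>v (n * n)" unfolding vX[symmetric] by (simp only: vec_of_mat_zero)
  with x(2) show False by simp
qed

text \<open>At most one nonzero entry per row. The witness \<open>A\<close>, its transposed rank-one
  update, both Krylov matrices and the explicit \<open>P0\<close> all have this shape, so products
  with them are mere reindexings.\<close>

definition monomial_mat :: "nat \<Rightarrow> (nat \<Rightarrow> nat) \<Rightarrow> (nat \<Rightarrow> 'a :: comm_ring_1) \<Rightarrow> 'a mat" where
  "monomial_mat n g a = mat n n (\<lambda>(i, j). if j = g i then a i else 0)"

lemma monomial_mat_carrier [simp]: "monomial_mat n g a \<in> carrier_mat n n"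
  by (simp add: monomial_mat_def)

lemma monomial_mat_mult_index:
  assumes "M \<in> carrier_mat n n" "i < n" "j < n" "g i < n"
  shows "(monomial_mat n g a * M) $$ (i, j) = a i * M $$ (g i, j)"
proof -
  have "(monomial_mat n g a * M) $$ (i, j) = (\<Sum>k\<in>{0..<n}. (if k = g i then a i else 0) * M $$ (k, j))"
    using assms by (simp add: monomial_mat_def scalar_prod_def)
  also have "\<dots> = (\<Sum>k\<in>{0..<n}. if k = g i then a i * M $$ (k, j) else 0)"
    by (intro sum.cong) auto
  also have "\<dots> = a i * M $$ (g i, j)" using assms by simp
  finally show ?thesis .
qed

lemma monomial_mat_mult_vec_index:
  assumes "x \<in> carrier_vec n" "i < n" "g i < n"
  shows "(monomial_mat n g a *\<^sub>v x) $ i = a i * x $ g i"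
proof -
  have "(monomial_mat n g a *\<^sub>v x) $ i = (\<Sum>k\<in>{0..<n}. (if k = g i then a i else 0) * x $ k)"
    using assms by (simp add: monomial_mat_def scalar_prod_def)
  also have "\<dots> = (\<Sum>k\<in>{0..<n}. if k = g i then a i * x $ k else 0)"
    by (intro sum.cong) auto
  also have "\<dots> = a i * x $ g i" using assms by simp
  finally show ?thesis .
qed

lemma monomial_sandwich_index:
  assumes M: "M \<in> carrier_mat n n" and ij: "i < n" "j < n" "g i < n" "h j < n"
  shows "(monomial_mat n g a * M * transpose_mat (monomial_mat n h b)) $$ (i, j) = a i * b j * M $$ (g i, h j)"
proof -
  let ?N = "monomial_mat n g a * M"
  have N: "?N \<in> carrier_mat n n" using M by (simp add: sq_carrier[of _ n])
  have "(?N * transpose_mat (monomial_mat n h b)) $$ (i, j)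
      = transpose_mat (monomial_mat n h b * transpose_mat ?N) $$ (i, j)"
    using N by (simp add: transpose_mult[of _ n n _ n])
  also have "\<dots> = (monomial_mat n h b * transpose_mat ?N) $$ (j, i)"
    using ij M by (intro index_transpose_mat) (auto simp: monomial_mat_def)
  also have "\<dots> = b j * ?N $$ (i, h j)"
    using ij N carrier_matD[OF N] by (subst monomial_mat_mult_index) (auto simp del: index_mult_mat)
  also have "?N $$ (i, h j) = a i * M $$ (g i, h j)"
    using ij M by (intro monomial_mat_mult_index) auto
  finally show ?thesis by (simp add: mult_ac)
qed

lemma det_monomial_mat_nonzero:
  fixes a b :: "nat \<Rightarrow> 'a :: field"
  assumes "\<And>i. i < n \<Longrightarrow> g i < n \<and> h (g i) = i \<and> a i * b (g i) = 1"
  shows "det (monomial_mat n g a) \<noteq> 0"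
proof -
  have "monomial_mat n g a * monomial_mat n h b = 1\<^sub>m n"
  proof (rule mat_eqI[of _ n])
    fix i j assume ij: "i < n" "j < n"
    then have "(monomial_mat n g a * monomial_mat n h b) $$ (i, j) = a i * monomial_mat n h b $$ (g i, j)"
      using assms by (intro monomial_mat_mult_index) auto
    then show "(monomial_mat n g a * monomial_mat n h b) $$ (i, j) = 1\<^sub>m n $$ (i, j)"
      using ij assms[of i] by (auto simp: monomial_mat_def)
  qed (auto simp: sq_carrier[of _ n])
  then have "det (monomial_mat n g a) * det (monomial_mat n h b) = 1"
    using det_mult[of "monomial_mat n g a" n "monomial_mat n h b"] by simp
  then show ?thesis by auto
qed

text \<open>With entries of size at most 1/2 on both sides, the map X -> G X H^T shrinks the maximum
  norm by the factor 1/4, so its only fixed point is 0.\<close>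

lemma monomial_contraction:
  fixes a b :: "nat \<Rightarrow> real"
  assumes n: "0 < n"
    and g: "\<And>i. i < n \<Longrightarrow> g i < n" and h: "\<And>i. i < n \<Longrightarrow> h i < n"
    and a: "\<And>i. \<bar>a i\<bar> \<le> 1 / 2" and b: "\<And>i. \<bar>b i\<bar> \<le> 1 / 2"
  shows "det (I_minus_kron (monomial_mat n h b) (monomial_mat n g a)) \<noteq> 0"
proof (rule det_I_minus_kron_nonzero[of _ n])
  fix X assume X: "X \<in> carrier_mat n n" and eq: "X = monomial_mat n g a * X * transpose_mat (monomial_mat n h b)"
  define S where "S = (\<lambda>(i, j). \<bar>X $$ (i, j)\<bar>) ` ({..<n} \<times> {..<n})"
  have S: "finite S" "S \<noteq> {}" using n by (auto simp: S_def)
  have le: "\<bar>X $$ (i, j)\<bar> \<le> Max S" if "i < n" "j < n" for i j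
    using that S by (intro Max_ge) (auto simp: S_def)
  have "Max S \<in> S" using S by (rule Max_in)
  then obtain i j where ij: "i < n" "j < n" "Max S = \<bar>X $$ (i, j)\<bar>" by (auto simp: S_def)
  have "X $$ (i, j) = a i * b j * X $$ (g i, h j)"
    by (subst eq, rule monomial_sandwich_index[where g = g and h = h]) (use X ij g h in auto)
  then have "Max S = \<bar>a i\<bar> * \<bar>b j\<bar> * \<bar>X $$ (g i, h j)\<bar>" by (simp add: ij abs_mult)
  also have "\<dots> \<le> (1 / 2 * (1 / 2)) * Max S"
    using le[OF g[OF ij(1)] h[OF ij(2)]] a b by (intro mult_mono) auto
  finally have "Max S \<le> 0" by simp
  then show "X = 0\<^sub>m n n"
    using X by (intro mat_eqI[of _ n]) (use le in fastforce)+
qed auto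

context
  fixes n :: nat
  assumes n: "0 < n"
begin

definition "cyc_pred i = (if i = 0 then n - 1 else i - 1)" for i :: nat
definition "cyc_succ i = (if Suc i = n then 0 else Suc i)" for i :: nat

lemma cyc_inverse: "i < n \<Longrightarrow> cyc_pred i < n" "i < n \<Longrightarrow> cyc_succ i < n" "i < n \<Longrightarrow> cyc_succ (cyc_pred i) = i" "i < n \<Longrightarrow> cyc_pred (cyc_succ i) = i"
  using n by (auto simp: cyc_pred_def cyc_succ_def)

text \<open>Half a cyclic shift; the rank-one update then removes the wrap-around entry, so that \<open>A2\<close> is nilpotent.\<close>

definition "witness_A = monomial_mat n cyc_pred (\<lambda>_. 1 / 2 :: real)"
definition "witness_v = vec n (\<lambda>i. if i = 0 then 1 else 0 :: real)"
definition "witness_w = vec n (\<lambda>i. if Suc i = n then - 1 / 2 else 0 :: real)"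

lemma witness_carrier: "witness_A \<in> carrier_mat n n" "witness_v \<in> carrier_vec n" "witness_w \<in> carrier_vec n"
  by (auto simp: witness_A_def witness_v_def witness_w_def)

lemma transpose_A2_witness:
  "transpose_mat (A2 witness_A witness_v witness_w) = monomial_mat n cyc_succ (\<lambda>i. if Suc i = n then 0 else 1 / 2)"
  using n by (intro mat_eqI[of _ n])
    (auto simp: A2_def witness_A_def witness_v_def witness_w_def monomial_mat_def cyc_pred_def cyc_succ_def outer_def split: if_splits)

text \<open>Each step halves and shifts the basis vector e_0; with fewer than n steps the
  wrap-around is never reached.\<close>

lemma krylov_witness_A: "krylov witness_A witness_v = monomial_mat n id (\<lambda>i. (1 / 2) ^ i)"
proof -
  have "witness_A ^\<^sub>m j *\<^sub>v witness_v = vec n (\<lambda>i. if i = j then (1 / 2) ^ j else 0)" if "j < n" for j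
    using that
  proof (induction j)
    case 0
    then show ?case using witness_carrier by (simp add: witness_v_def carrier_matD(1)[OF witness_carrier(1)] cong: if_cong)
  next
    case (Suc j)
    have "witness_A ^\<^sub>m Suc j *\<^sub>v witness_v = witness_A *\<^sub>v vec n (\<lambda>i. if i = j then (1 / 2) ^ j else 0)"
      using Suc by (simp add: pow_Suc_vec[OF witness_carrier(1,2)] del: pow_mat.simps)
    also have "\<dots> = vec n (\<lambda>i. if i = Suc j then (1 / 2) ^ Suc j else 0)"
    proof (rule eq_vecI)
      fix i assume "i < dim_vec (vec n (\<lambda>i. if i = Suc j then (1 / 2) ^ Suc j else 0 :: real))"
      then have i: "i < n" by simp
      show "(witness_A *\<^sub>v vec n (\<lambda>i. if i = j then (1 / 2) ^ j else 0)) $ i = vec n (\<lambda>i. if i = Suc j then (1 / 2) ^ Suc j else 0) $ i"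
        unfolding witness_A_def using i cyc_inverse Suc.prems
        by (subst monomial_mat_mult_vec_index) (auto simp: cyc_pred_def)
    qed (simp add: witness_A_def monomial_mat_def)
    finally show ?case .
  qed
  then have "krylov witness_A witness_v $$ (i, j) = (if i = j then (1 / 2) ^ j else 0)" if "i < n" "j < n" for i j
    using that by (simp add: krylov_index[OF witness_carrier(1)])
  then show ?thesis
    using krylov_carrier[OF witness_carrier(1)] by (intro mat_eqI[of _ n]) (auto simp: monomial_mat_def)
qed

text \<open>Here the shift runs backwards from position n - 1. Column j is supported in row n - 1 -
  j, and the initial factor -1/2 of \<open>w\<close> raises the exponent to j + 1 = n - i.\<close>

lemma krylov_witness_w:
  "krylov (transpose_mat (A2 witness_A witness_v witness_w)) witness_w = monomial_mat n (\<lambda>i. n - Suc i) (\<lambda>i. - ((1 / 2) ^ (n - i)))"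
proof -
  let ?F = "monomial_mat n cyc_succ (\<lambda>i. if Suc i = n then 0 else 1 / 2 :: real)"
  have "?F ^\<^sub>m j *\<^sub>v witness_w = vec n (\<lambda>i. if Suc (i + j) = n then - ((1 / 2) ^ Suc j) else 0)" if "j < n" for j
    using that
  proof (induction j)
    case 0
    then show ?case using witness_carrier by (simp add: witness_w_def carrier_matD(1)[OF monomial_mat_carrier] cong: if_cong)
  next
    case (Suc j)
    have "?F ^\<^sub>m Suc j *\<^sub>v witness_w = ?F *\<^sub>v vec n (\<lambda>i. if Suc (i + j) = n then - ((1 / 2) ^ Suc j) else 0)"
      using Suc by (simp add: pow_Suc_vec[OF monomial_mat_carrier witness_carrier(3)] del: pow_mat.simps)
    also have "\<dots> = vec n (\<lambda>i. if Suc (i + Suc j) = n then - ((1 / 2) ^ Suc (Suc j)) else 0)"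
    proof (rule eq_vecI)
      fix i assume "i < dim_vec (vec n (\<lambda>i. if Suc (i + Suc j) = n then - ((1 / 2) ^ Suc (Suc j)) else 0 :: real))"
      then have i: "i < n" by simp
      show "(?F *\<^sub>v vec n (\<lambda>i. if Suc (i + j) = n then - ((1 / 2) ^ Suc j) else 0)) $ i
          = vec n (\<lambda>i. if Suc (i + Suc j) = n then - ((1 / 2) ^ Suc (Suc j)) else 0) $ i"
        using i cyc_inverse Suc.prems
        by (subst monomial_mat_mult_vec_index) (auto simp: cyc_succ_def)
    qed (simp add: monomial_mat_def)
    finally show ?case .
  qed
  then have "krylov ?F witness_w $$ (i, j) = (if Suc (i + j) = n then - ((1 / 2) ^ Suc j) else 0)" if "i < n" "j < n" for i j
    using that by (simp add: krylov_index[OF monomial_mat_carrier])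
  moreover have "n - i = Suc (n - Suc i)" if "i < n" for i
    using that by simp
  ultimately show ?thesis
    unfolding transpose_A2_witness
    by (intro mat_eqI[of _ n]) (auto simp: monomial_mat_def[of n "\<lambda>i. n - Suc i"] krylov_carrier)
qed

lemma generic_point_witness: "generic_point witness_A witness_v witness_w \<noteq> 0"
proof -
  have P: "delta_P witness_A \<noteq> 0"
    unfolding delta_P_def witness_A_def using n cyc_inverse by (intro monomial_contraction) auto
  have Q: "delta_Q witness_A witness_v witness_w \<noteq> 0"
    unfolding delta_Q_def transpose_A2_witness using n cyc_inverse by (intro monomial_contraction) auto
  have R: "delta_R witness_A witness_v witness_w \<noteq> 0"
    unfolding delta_R_def transpose_A2_witness unfolding witness_A_def using n cyc_inverse by (intro monomial_contraction) auto
  have A: "det witness_A \<noteq> 0"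
    unfolding witness_A_def using cyc_inverse
    by (intro det_monomial_mat_nonzero[where h = cyc_succ and b = "\<lambda>_. 2"]) auto
  have K: "det (krylov witness_A witness_v) \<noteq> 0"
    unfolding krylov_witness_A
    by (intro det_monomial_mat_nonzero[where h = id and b = "\<lambda>i. 2 ^ i"]) (auto simp: power_divide)
  have L: "det (krylov (transpose_mat (A2 witness_A witness_v witness_w)) witness_w) \<noteq> 0"
    unfolding krylov_witness_w
    by (intro det_monomial_mat_nonzero[where h = "\<lambda>i. n - Suc i" and b = "\<lambda>i. - (2 ^ Suc i)"])
       (auto simp: power_divide Suc_diff_Suc)
  \<comment> \<open>A diagonal ansatz for \<open>P\<close> requires p_i = p_(i-1) / 4 for i > 0 and
    p_0 = p_(n-1) / 4 + 1. Going once round the cycle gives p_0 (1 - 4^-n) = 1, so p_0 = 1 /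
    c.\<close>
  define c :: real where "c = 1 - (1 / 4) ^ n"
  have "(1 / 4 :: real) ^ n \<le> (1 / 4) ^ 1" using n by (intro power_decreasing) auto
  then have c: "c \<noteq> 0" by (simp add: c_def)
  define P0 where "P0 = monomial_mat n id (\<lambda>i. (1 / 4) ^ i / c)"
  have P0: "P0 \<in> carrier_mat n n" by (simp add: P0_def)
  have P0_eq: "P0 = witness_A * P0 * transpose_mat witness_A + outer witness_v witness_v"
  proof (rule mat_eqI[of _ n])
    fix i j assume ij: "i < n" "j < n"
    have "(witness_A * P0 * transpose_mat witness_A + outer witness_v witness_v) $$ (i, j)
        = (witness_A * P0 * transpose_mat witness_A) $$ (i, j) + (if i = 0 \<and> j = 0 then 1 else 0)"
      using ij witness_carrier by (auto simp: witness_v_def simp del: index_mult_mat(1))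
    also have "(witness_A * P0 * transpose_mat witness_A) $$ (i, j) = 1 / 4 * P0 $$ (cyc_pred i, cyc_pred j)"
      unfolding witness_A_def using ij cyc_inverse P0 by (subst monomial_sandwich_index) auto
    also have "P0 $$ (cyc_pred i, cyc_pred j) = (if i = j then (1 / 4) ^ cyc_pred i / c else 0)"
      using ij cyc_inverse by (auto simp: P0_def monomial_mat_def) (metis cyc_inverse(3))
    also have "1 / 4 * (if i = j then (1 / 4) ^ cyc_pred i / c else 0) + (if i = 0 \<and> j = 0 then 1 else 0)
        = P0 $$ (i, j)"
    proof (cases "i = 0 \<and> j = 0")
      case True
      have "(1 / 4 :: real) * (1 / 4) ^ (n - 1) = (1 / 4) ^ n"
        using n by (cases n) auto
      with True c n show ?thesis
        by (simp add: P0_def monomial_mat_def cyc_pred_def field_simps) (simp add: c_def field_simps)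
    next
      case False
      then show ?thesis using ij by (cases i) (auto simp: P0_def monomial_mat_def cyc_pred_def)
    qed
    finally show "P0 $$ (i, j) = (witness_A * P0 * transpose_mat witness_A + outer witness_v witness_v) $$ (i, j)" ..
  qed (use P0 witness_carrier in \<open>auto simp: sq_carrier[of _ n]\<close>)
  have "det P0 \<noteq> 0"
    unfolding P0_def using c
    by (intro det_monomial_mat_nonzero[where h = id and b = "\<lambda>i. 4 ^ i * c"]) (auto simp: power_divide)
  have hat: "P_hat witness_A witness_v = sylvester_adj n witness_A witness_A (outer witness_v witness_v)"
    using witness_carrier by (simp add: P_hat_def sylvester_adj_def)
  note syl = sylvester_adj[OF witness_carrier(1,1) outer_carrier[OF witness_carrier(2,2)], folded hat delta_P_def]
  have "P_hat witness_A witness_v = delta_P witness_A \<cdot>\<^sub>m P0"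
  proof (rule affine_solution_unique[where G = witness_A and H = "transpose_mat witness_A" and Z = "delta_P witness_A \<cdot>\<^sub>m outer witness_v witness_v"])
    show "X = 0\<^sub>m n n" if "X \<in> carrier_mat n n" "X = witness_A * X * transpose_mat witness_A" for X
      using sylvester_unique[OF witness_carrier(1,1) that(1) _ that(2)] P by (simp add: delta_P_def)
    show "P_hat witness_A witness_v = witness_A * P_hat witness_A witness_v * transpose_mat witness_A + delta_P witness_A \<cdot>\<^sub>m outer witness_v witness_v"
      unfolding syl(2)[symmetric] using syl(1) witness_carrier
      by (intro mat_eqI[of _ n]) (auto simp: sq_carrier[of _ n] simp del: index_mult_mat(1))
    have "delta_P witness_A \<cdot>\<^sub>m P0 = delta_P witness_A \<cdot>\<^sub>m (witness_A * P0 * transpose_mat witness_A + outer witness_v witness_v)"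
      using P0_eq by simp
    also have "\<dots> = witness_A * (delta_P witness_A \<cdot>\<^sub>m P0) * transpose_mat witness_A + delta_P witness_A \<cdot>\<^sub>m outer witness_v witness_v"
      using P0 witness_carrier
      by (simp add: sq[of _ n] add_smult_distrib_left_mat[of _ n n])
    finally show "delta_P witness_A \<cdot>\<^sub>m P0 = witness_A * (delta_P witness_A \<cdot>\<^sub>m P0) * transpose_mat witness_A + delta_P witness_A \<cdot>\<^sub>m outer witness_v witness_v" .
  qed (use syl(1) P0 witness_carrier in auto)
  then have "det (P_hat witness_A witness_v) \<noteq> 0"
    using \<open>det P0 \<noteq> 0\<close> P by simp
  with P Q R A K L show ?thesis by (simp add: generic_point_def)
qed

end

section \<open>The identity at generic points\<close>

lemma (in comm_ring_hom) hom_generic_point: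
  assumes "A \<in> carrier_mat n n" "v \<in> carrier_vec n" "w \<in> carrier_vec n"
  shows "hom (generic_point A v w) = generic_point (mat\<^sub>h A) (vec\<^sub>h v) (vec\<^sub>h w)"
proof -
  have At: "transpose_mat (A2 A v w) \<in> carrier_mat n n"
    using A2_carrier[OF assms] by simp
  show ?thesis
    unfolding generic_point_def hom_mult hom_delta_P[OF assms] hom_delta_Q[OF assms] hom_delta_R[OF assms]
      hom_det[symmetric] hom_P_hat[OF assms] hom_krylov[OF assms] hom_krylov[OF At assms(3,3)]
      mat_hom_transpose mat_hom_A2[OF assms] ..
qed

lemma adj_mat_smult:
  assumes "M \<in> carrier_mat n n"
  shows "adj_mat (a \<cdot>\<^sub>m M) = a ^ (n - 1) \<cdot>\<^sub>m adj_mat M"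
proof (rule eq_matI)
  fix i j assume "i < dim_row (a ^ (n - 1) \<cdot>\<^sub>m adj_mat M)" "j < dim_col (a ^ (n - 1) \<cdot>\<^sub>m adj_mat M)"
  then have ij: "i < n" "j < n" using assms by (auto simp: adj_mat_def)
  have "mat_delete (a \<cdot>\<^sub>m M) j i = a \<cdot>\<^sub>m mat_delete M j i"
    by (rule eq_matI) (auto simp: mat_delete_def)
  then show "adj_mat (a \<cdot>\<^sub>m M) $$ (i, j) = (a ^ (n - 1) \<cdot>\<^sub>m adj_mat M) $$ (i, j)"
    using ij assms by (auto simp: adj_mat_def cofactor_def)
qed (use assms in \<open>auto simp: adj_mat_def\<close>)

text \<open>A count of homogeneity degrees. On the left the two determinants contribute the two
  factors of \<open>c\<close>. On the right the same power products come from the scalar prefactors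
  and from the factor \<open>delta_P A * delta_Q A v w\<close> of the pencil.\<close>

lemma hat_scaling:
  fixes A P Q R :: "'a :: comm_ring_1 mat"
  assumes n: "0 < n" and A: "A \<in> carrier_mat n n"
    and car: "P \<in> carrier_mat n n" "Q \<in> carrier_mat n n" "R \<in> carrier_mat n n"
    and hat: "P_hat A v = delta_P A \<cdot>\<^sub>m P" "Q_hat A v w = delta_Q A v w \<cdot>\<^sub>m Q" "R_hat A v w = delta_R A v w \<cdot>\<^sub>m R"
  defines "c \<equiv> (delta_P A * delta_Q A v w) ^ n * ((delta_R A v w)\<^sup>2 * delta_P A * delta_Q A v w ^ n) ^ n"
  shows "hat_lhs A v w = [:c:] * ([:det (1\<^sub>m n + P * Q):] *
       det (([:det Q:] * lam) \<cdot>\<^sub>m const_mat P - const_mat (R * adj_mat Q * transpose_mat R)))"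
    and "hat_rhs A v w = [:c:] * ([:det P * det Q ^ n:] *
       det ((lam - 1) \<cdot>\<^sub>m 1\<^sub>m n + lam \<cdot>\<^sub>m const_mat (P * Q)))"
proof -
  define p q r where "p = delta_P A" and "q = delta_Q A v w" and "r = delta_R A v w"
  note adj = adj_mat(1)[OF car(2)]
  note hat' = hat[folded p_def q_def r_def]
  have dimA: "dim_row A = n" using A by simp
  have PQ: "P * Q \<in> carrier_mat n n" using car by simp
  have S: "R * adj_mat Q * transpose_mat R \<in> carrier_mat n n" using car adj by (simp add: sq_carrier[of _ n])
  have N: "N_hat A v w = (p * q) \<cdot>\<^sub>m (1\<^sub>m n + P * Q)"
    unfolding N_hat_def hat' dimA p_def[symmetric] q_def[symmetric] using car
    by (simp add: mult_smult_distrib[of _ n n _ n] mult_smult_assoc_mat[of _ n n _ n] smult_smult_mat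
        add_smult_distrib_left_mat[of _ n n] mult.commute)
  have detN: "det (N_hat A v w) = (p * q) ^ n * det (1\<^sub>m n + P * Q)"
    unfolding N using PQ carrier_matD[OF car(2)] by simp
  \<comment> \<open>The adjugate scales with degree n - 1; the extra \<open>delta_Q\<close> in front
    of it completes the degree to n.\<close>
  have q: "q * q ^ (n - 1) = q ^ n" using n by (cases n) auto
  have "(p * q) \<cdot>\<^sub>m ((r \<cdot>\<^sub>m R) * adj_mat (q \<cdot>\<^sub>m Q) * transpose_mat (r \<cdot>\<^sub>m R))
      = (r\<^sup>2 * p * (q * q ^ (n - 1))) \<cdot>\<^sub>m (R * adj_mat Q * transpose_mat R)"
    using car adj unfolding adj_mat_smult[OF car(2)]
    by (simp add: transpose_smult mult_smult_distrib[of _ n n _ n] mult_smult_assoc_mat[of _ n n _ n] smult_smult_mat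
        sq_carrier[of _ n] power2_eq_square mult_ac del: assoc_mult_mat)
  then have S': "(p * q) \<cdot>\<^sub>m ((r \<cdot>\<^sub>m R) * adj_mat (q \<cdot>\<^sub>m Q) * transpose_mat (r \<cdot>\<^sub>m R))
      = (r\<^sup>2 * p * q ^ n) \<cdot>\<^sub>m (R * adj_mat Q * transpose_mat R)"
    unfolding q .
  have detQ: "det (q \<cdot>\<^sub>m Q) = q ^ n * det Q" and detP: "det (p \<cdot>\<^sub>m P) = p ^ n * det P"
    using car by auto
  let ?M = "([:det Q:] * lam) \<cdot>\<^sub>m const_mat P - const_mat (R * adj_mat Q * transpose_mat R)"
  have "([:r\<^sup>2 * (q ^ n * det Q):] * lam) \<cdot>\<^sub>m const_mat (p \<cdot>\<^sub>m P)
      - const_mat ((r\<^sup>2 * p * q ^ n) \<cdot>\<^sub>m (R * adj_mat Q * transpose_mat R)) = [:r\<^sup>2 * p * q ^ n:] \<cdot>\<^sub>m ?M"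
    unfolding const_mat_smult using car S
    by (subst smult_diff_mat[of _ n n]) (auto simp: smult_smult_mat mult_ac)
  moreover have "?M \<in> carrier_mat n n" using car S by (auto simp: minus_carrier_mat)
  ultimately have "det (([:r\<^sup>2 * (q ^ n * det Q):] * lam) \<cdot>\<^sub>m const_mat (p \<cdot>\<^sub>m P)
      - const_mat ((r\<^sup>2 * p * q ^ n) \<cdot>\<^sub>m (R * adj_mat Q * transpose_mat R))) = [:(r\<^sup>2 * p * q ^ n) ^ n:] * det ?M"
    using carrier_matD[of ?M n n] by (simp add: poly_const_pow)
  then show "hat_lhs A v w = [:c:] * ([:det (1\<^sub>m n + P * Q):] * det ?M)"
    unfolding hat_lhs_def Let_def hat' detN detQ p_def[symmetric] q_def[symmetric] r_def[symmetric] S' c_def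
    by (simp add: mult_ac)
  let ?L = "(lam - 1) \<cdot>\<^sub>m 1\<^sub>m n + lam \<cdot>\<^sub>m const_mat (P * Q)"
  have L: "?L \<in> carrier_mat n n" using PQ by simp
  have "((lam - 1) * [:p * q:]) \<cdot>\<^sub>m 1\<^sub>m n + lam \<cdot>\<^sub>m const_mat ((p \<cdot>\<^sub>m P) * (q \<cdot>\<^sub>m Q)) = [:p * q:] \<cdot>\<^sub>m ?L"
    using car PQ
    by (simp add: mult_smult_distrib[of _ n n _ n] mult_smult_assoc_mat[of _ n n _ n] const_mat_smult
        smult_smult_mat add_smult_distrib_left_mat[of _ n n] mult_ac)
  then have "det (((lam - 1) * [:p * q:]) \<cdot>\<^sub>m 1\<^sub>m n + lam \<cdot>\<^sub>m const_mat ((p \<cdot>\<^sub>m P) * (q \<cdot>\<^sub>m Q)))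
      = [:(p * q) ^ n:] * det ?L"
    using carrier_matD[OF L] by (simp add: poly_const_pow)
  moreover have "r ^ (2 * n) * (p ^ n * det P) * (q ^ n * det Q) ^ n = (r\<^sup>2 * p * q ^ n) ^ n * (det P * det Q ^ n)"
    unfolding power_mult[of r 2 n] by (simp add: power_mult_distrib mult_ac)
  ultimately show "hat_rhs A v w = [:c:] * ([:det P * det Q ^ n:] * det ?L)"
    unfolding hat_rhs_def Let_def hat' detP detQ dimA p_def[symmetric] q_def[symmetric] r_def[symmetric] c_def
    by (simp add: mult_ac)
qed

lemma hats_eq_sylvester_adj:
  assumes "A \<in> carrier_mat n n" "v \<in> carrier_vec n" "w \<in> carrier_vec n"
  shows "P_hat A v = sylvester_adj n A A (outer v v)"
    "Q_hat A v w = sylvester_adj n (transpose_mat (A2 A v w)) (transpose_mat (A2 A v w)) (outer w w)"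
    "R_hat A v w = sylvester_adj n (transpose_mat (A2 A v w)) A (outer v w)"
  using assms by (simp_all add: P_hat_def Q_hat_def R_hat_def sylvester_adj_def)

lemma sylvester_solution:
  fixes F G Y :: "'a :: field mat"
  assumes F: "F \<in> carrier_mat n n" and G: "G \<in> carrier_mat n n" and Y: "Y \<in> carrier_mat n n"
    and det: "det (I_minus_kron F G) \<noteq> 0"
  obtains X where "X \<in> carrier_mat n n" "X = G * X * transpose_mat F + Y"
    "sylvester_adj n F G Y = det (I_minus_kron F G) \<cdot>\<^sub>m X"
    "\<forall>X'\<in>carrier_mat n n. X' = G * X' * transpose_mat F + Y \<longrightarrow> X' = X"
proof -
  let ?d = "det (I_minus_kron F G)" and ?S = "sylvester_adj n F G Y"
  note S = sylvester_adj[OF F G Y]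
  define X where "X = (1 / ?d) \<cdot>\<^sub>m ?S"
  have X: "X \<in> carrier_mat n n" using S by (simp add: X_def)
  have SX: "?S = ?d \<cdot>\<^sub>m X" using det by (simp add: X_def smult_smult_mat)
  have eq: "X = G * X * transpose_mat F + Y"
  proof (rule mat_eqI[of _ n])
    fix i j assume ij: "i < n" "j < n"
    have "?d \<cdot>\<^sub>m X - ?d \<cdot>\<^sub>m (G * X * transpose_mat F) = ?d \<cdot>\<^sub>m Y"
      using S(2) F G X unfolding SX by (simp add: sq[of _ n])
    from mat_index_eq[OF this, of i j]
    have "?d * (X $$ (i, j) - (G * X * transpose_mat F) $$ (i, j)) = ?d * Y $$ (i, j)"
      using ij X F G Y by (simp add: right_diff_distrib del: index_mult_mat(1))
    then show "X $$ (i, j) = (G * X * transpose_mat F + Y) $$ (i, j)"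
      using det ij F G X Y by (simp add: diff_eq_eq add.commute del: index_mult_mat(1))
  qed (use X F G Y in auto)
  show thesis
  proof (rule that[OF X eq SX], intro ballI impI)
    fix X' assume X': "X' \<in> carrier_mat n n" "X' = G * X' * transpose_mat F + Y"
    show "X' = X"
    proof (rule affine_solution_unique[where G = G and H = "transpose_mat F" and Z = Y])
      show "Z = 0\<^sub>m n n" if "Z \<in> carrier_mat n n" "Z = G * Z * transpose_mat F" for Z
        by (rule sylvester_unique[OF F G that(1) det that(2)])
    qed (use X' X F G Y eq in auto)
  qed
qed

lemma domain_solutions:
  fixes A :: "real mat"
  assumes A: "A \<in> carrier_mat n n" and v: "v \<in> carrier_vec n" and w: "w \<in> carrier_vec n"
    and nz: "delta_P A * delta_Q A v w * delta_R A v w \<noteq> 0"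
  shows "\<exists>!X. solves_P A v X" "\<exists>!X. solves_Q A v w X" "\<exists>!X. solves_R A v w X"
    "P_hat A v = delta_P A \<cdot>\<^sub>m sol_P A v"
    "Q_hat A v w = delta_Q A v w \<cdot>\<^sub>m sol_Q A v w"
    "R_hat A v w = delta_R A v w \<cdot>\<^sub>m sol_R A v w"
proof -
  have A2: "A2 A v w \<in> carrier_mat n n" using A v w by (simp add: A2_def)
  then have A2t: "transpose_mat (A2 A v w) \<in> carrier_mat n n" by simp
  have d: "delta_P A \<noteq> 0" "delta_Q A v w \<noteq> 0" "delta_R A v w \<noteq> 0" using nz by auto
  note hats = hats_eq_sylvester_adj[OF A v w]
  have dimA: "dim_row A = n" using A by simp
  obtain X where X: "X \<in> carrier_mat n n" "X = A * X * transpose_mat A + outer v v"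
    "sylvester_adj n A A (outer v v) = delta_P A \<cdot>\<^sub>m X"
    "\<forall>X'\<in>carrier_mat n n. X' = A * X' * transpose_mat A + outer v v \<longrightarrow> X' = X"
    unfolding delta_P_def by (rule sylvester_solution[OF A A outer_carrier[OF v v] d(1)[unfolded delta_P_def]])
  have "solves_P A v X" and P: "\<And>X'. solves_P A v X' \<Longrightarrow> X' = X"
    using X unfolding solves_P_def dimA by blast+
  then show "\<exists>!X. solves_P A v X" by blast
  moreover have "sol_P A v = X" unfolding sol_P_def using \<open>solves_P A v X\<close> P by (rule the_equality)
  ultimately show "P_hat A v = delta_P A \<cdot>\<^sub>m sol_P A v" using X(3) hats by simp
  obtain Y where Y: "Y \<in> carrier_mat n n" "Y = transpose_mat (A2 A v w) * Y * A2 A v w + outer w w"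
    "sylvester_adj n (transpose_mat (A2 A v w)) (transpose_mat (A2 A v w)) (outer w w) = delta_Q A v w \<cdot>\<^sub>m Y"
    "\<forall>X'\<in>carrier_mat n n. X' = transpose_mat (A2 A v w) * X' * A2 A v w + outer w w \<longrightarrow> X' = Y"
    unfolding delta_Q_def
    by (rule sylvester_solution[OF A2t A2t outer_carrier[OF w w] d(2)[unfolded delta_Q_def], unfolded transpose_transpose])
  have "solves_Q A v w Y" and Q: "\<And>X'. solves_Q A v w X' \<Longrightarrow> X' = Y"
    using Y unfolding solves_Q_def dimA by blast+
  then show "\<exists>!X. solves_Q A v w X" by blast
  moreover have "sol_Q A v w = Y" unfolding sol_Q_def using \<open>solves_Q A v w Y\<close> Q by (rule the_equality)
  ultimately show "Q_hat A v w = delta_Q A v w \<cdot>\<^sub>m sol_Q A v w" using Y(3) hats by simp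
  obtain Z where Z: "Z \<in> carrier_mat n n" "Z = A * Z * A2 A v w + outer v w"
    "sylvester_adj n (transpose_mat (A2 A v w)) A (outer v w) = delta_R A v w \<cdot>\<^sub>m Z"
    "\<forall>X'\<in>carrier_mat n n. X' = A * X' * A2 A v w + outer v w \<longrightarrow> X' = Z"
    unfolding delta_R_def
    by (rule sylvester_solution[OF A2t A outer_carrier[OF v w] d(3)[unfolded delta_R_def], unfolded transpose_transpose])
  have "solves_R A v w Z" and R: "\<And>X'. solves_R A v w X' \<Longrightarrow> X' = Z"
    using Z unfolding solves_R_def dimA by blast+
  then show "\<exists>!X. solves_R A v w X" by blast
  moreover have "sol_R A v w = Z" unfolding sol_R_def using \<open>solves_R A v w Z\<close> R by (rule the_equality)
  ultimately show "R_hat A v w = delta_R A v w \<cdot>\<^sub>m sol_R A v w" using Z(3) hats by simp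
qed

lemma sol_solves:
  fixes A :: "real mat"
  assumes A: "A \<in> carrier_mat n n" and v: "v \<in> carrier_vec n" and w: "w \<in> carrier_vec n"
    and nz: "delta_P A * delta_Q A v w * delta_R A v w \<noteq> 0"
  shows "solves_P A v (sol_P A v)" "solves_Q A v w (sol_Q A v w)" "solves_R A v w (sol_R A v w)"
  unfolding sol_P_def sol_Q_def sol_R_def
  by (rule theI'[OF domain_solutions(1)[OF assms]], rule theI'[OF domain_solutions(2)[OF assms]],
      rule theI'[OF domain_solutions(3)[OF assms]])

lemma hat_identity_generic:
  fixes A :: "real mat"
  assumes n: "0 < n" and A: "A \<in> carrier_mat n n" and v: "v \<in> carrier_vec n" and w: "w \<in> carrier_vec n"
    and gen: "generic_point A v w \<noteq> 0"
  shows "hat_lhs A v w = hat_rhs A v w"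
proof -
  have A2: "A2 A v w \<in> carrier_mat n n" using A v w by (simp add: A2_def)
  have A2t: "transpose_mat (A2 A v w) \<in> carrier_mat n n" using A2 by simp
  have At: "transpose_mat A \<in> carrier_mat n n" using A by simp
  have nz: "delta_P A * delta_Q A v w * delta_R A v w \<noteq> 0"
    and nz': "det (P_hat A v) \<noteq> 0" "det A \<noteq> 0" "det (krylov A v) \<noteq> 0"
      "det (krylov (transpose_mat (A2 A v w)) w) \<noteq> 0"
    using gen by (auto simp: generic_point_def)
  then have d: "det (I_minus_kron A A) \<noteq> 0"
    "det (I_minus_kron (transpose_mat (A2 A v w)) (transpose_mat (A2 A v w))) \<noteq> 0"
    "det (I_minus_kron (transpose_mat (A2 A v w)) A) \<noteq> 0"
    by (auto simp: delta_P_def delta_Q_def delta_R_def)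
  have d': "det (I_minus_kron (transpose_mat A) (transpose_mat A)) \<noteq> 0"
    unfolding I_minus_kron_transpose[OF A A] using d(1) by (simp add: det_transpose[OF I_minus_kron_carrier[OF A A]])
  note hats = domain_solutions(4-6)[OF A v w nz]
  note sols = sol_solves[OF A v w nz]
  have dimA: "dim_row A = n" using A by simp
  have car: "sol_P A v \<in> carrier_mat n n" "sol_Q A v w \<in> carrier_mat n n" "sol_R A v w \<in> carrier_mat n n"
    using sols by (simp_all add: solves_P_def solves_Q_def solves_R_def dimA)
  interpret gramians n A "sol_P A v" "sol_Q A v w" "sol_R A v w" v w "A2 A v w"
  proof
    show "det (sol_P A v) \<noteq> 0" using nz'(1) by (auto simp: hats)
    show "X = 0\<^sub>m n n" if "X \<in> carrier_mat n n" "X = A * X * transpose_mat A" for X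
      by (rule sylvester_unique[OF A A that(1) d(1) that(2)])
    show "X = 0\<^sub>m n n" if "X \<in> carrier_mat n n" "X = transpose_mat A * X * A" for X
      using sylvester_unique[OF At At that(1) d'] that(2) by simp
    show "X = 0\<^sub>m n n" if "X \<in> carrier_mat n n" "X = transpose_mat (A2 A v w) * X * A2 A v w" for X
      using sylvester_unique[OF A2t A2t that(1) d(2)] that(2) by simp
    show "X = 0\<^sub>m n n" if "X \<in> carrier_mat n n" "X = A * X * A2 A v w" for X
      using sylvester_unique[OF A2t A that(1) d(3)] that(2) by simp
  qed (use n A v w nz' car sols in \<open>simp_all add: solves_P_def solves_Q_def solves_R_def A2_def\<close>)
  show ?thesis
    unfolding hat_scaling[OF n A car hats] pencil_identity ..
qed

section \<open>The identity everywhere\<close>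

lemma eval_line_mat:
  fixes M N :: "real mat"
  assumes "M \<in> carrier_mat n n" "N \<in> carrier_mat n n"
  shows "map_mat (\<lambda>p. poly p 1) (mat n n (\<lambda>ij. [:M $$ ij, N $$ ij - M $$ ij:])) = N"
    "map_mat (\<lambda>p. poly p 0) (mat n n (\<lambda>ij. [:M $$ ij, N $$ ij - M $$ ij:])) = M"
  using assms by (auto intro!: eq_matI)

lemma eval_line_vec:
  fixes x y :: "real vec"
  assumes "x \<in> carrier_vec n" "y \<in> carrier_vec n"
  shows "map_vec (\<lambda>p. poly p 1) (vec n (\<lambda>i. [:x $ i, y $ i - x $ i:])) = y"
    "map_vec (\<lambda>p. poly p 0) (vec n (\<lambda>i. [:x $ i, y $ i - x $ i:])) = x"
  using assms by (auto intro!: eq_vecI)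

text \<open>The line has the given point at parameter 0 and the witness at parameter 1, so
  \<open>D\<close> is a nonzero polynomial. Where \<open>D\<close> does not vanish the generic case
  applies; hence \<open>D\<close> times any coefficient of the difference vanishes at all reals and
  is the zero polynomial. Cancelling \<open>D\<close> and evaluating at 0 gives the claim.\<close>

lemma hat_identity:
  fixes A :: "real mat"
  assumes n: "0 < n" and A: "A \<in> carrier_mat n n" and v: "v \<in> carrier_vec n" and w: "w \<in> carrier_vec n"
  shows "hat_lhs A v w = hat_rhs A v w"
proof -
  note wit = witness_carrier[OF n]
  define Al where "Al = mat n n (\<lambda>ij. [:A $$ ij, witness_A n $$ ij - A $$ ij:])"
  define vl where "vl = vec n (\<lambda>i. [:v $ i, witness_v n $ i - v $ i:])"
  define wl where "wl = vec n (\<lambda>i. [:w $ i, witness_w n $ i - w $ i:])"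
  let ?h = "\<lambda>s p :: real poly. poly p s"
  have l: "Al \<in> carrier_mat n n" "vl \<in> carrier_vec n" "wl \<in> carrier_vec n"
    by (simp_all add: Al_def vl_def wl_def)
  have at1: "map_mat (?h 1) Al = witness_A n" "map_vec (?h 1) vl = witness_v n" "map_vec (?h 1) wl = witness_w n"
    unfolding Al_def vl_def wl_def
    using eval_line_mat(1)[OF A wit(1)] eval_line_vec(1)[OF v wit(2)] eval_line_vec(1)[OF w wit(3)] by auto
  have at0: "map_mat (?h 0) Al = A" "map_vec (?h 0) vl = v" "map_vec (?h 0) wl = w"
    unfolding Al_def vl_def wl_def
    using eval_line_mat(2)[OF A wit(1)] eval_line_vec(2)[OF v wit(2)] eval_line_vec(2)[OF w wit(3)] by auto
  define D where "D = generic_point Al vl wl"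
  have "poly D 1 \<noteq> 0"
    unfolding D_def poly_hom.hom_generic_point[OF l] at1 by (rule generic_point_witness[OF n])
  then have D: "D \<noteq> 0" by auto
  have coeff_at: "poly (coeff (hat_lhs Al vl wl - hat_rhs Al vl wl) k) s
      = coeff (hat_lhs (map_mat (?h s) Al) (map_vec (?h s) vl) (map_vec (?h s) wl)
          - hat_rhs (map_mat (?h s) Al) (map_vec (?h s) vl) (map_vec (?h s) wl)) k" for k s
    unfolding poly_hom.hom_hat_lhs[OF l, symmetric] poly_hom.hom_hat_rhs[OF l, symmetric]
    by (simp add: coeff_map_poly)
  have zero: "coeff (hat_lhs Al vl wl - hat_rhs Al vl wl) k = 0" for k
  proof -
    let ?c = "coeff (hat_lhs Al vl wl - hat_rhs Al vl wl) k"
    have "poly (D * ?c) s = 0" for s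
    proof (cases "poly D s = 0")
      case False
      then have "generic_point (map_mat (?h s) Al) (map_vec (?h s) vl) (map_vec (?h s) wl) \<noteq> 0"
        unfolding D_def poly_hom.hom_generic_point[OF l] .
      from hat_identity_generic[OF n _ _ _ this] l have "poly ?c s = 0"
        unfolding coeff_at by simp
      then show ?thesis by simp
    qed simp
    then have "D * ?c = 0" by (intro iffD1[OF poly_all_0_iff_0] allI)
    with D show ?thesis by simp
  qed
  show ?thesis
  proof (rule poly_eqI)
    fix k
    show "coeff (hat_lhs A v w) k = coeff (hat_rhs A v w) k"
      using coeff_at[of k 0] unfolding zero at0 by simp
  qed
qed

section \<open>Coefficients as formal polynomials in the parameters\<close>

lemma insertion_indet: "insertion \<sigma> (indet_poly x) = \<sigma> x"
  by (simp add: indet_poly_def insertion_single)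

lemma eval_at_eq_insertion: "eval_at A v w = insertion (indet_val A v w)"
  by (rule ext) (simp add: eval_at_def insertion_def)

lemma insertion_c_hat:
  "insertion \<sigma> (c_hat n k) =
    coeff (hat_lhs (mat n n (\<lambda>(i, j). \<sigma> (VarA i j))) (vec n (\<lambda>i. \<sigma> (Varv i))) (vec n (\<lambda>i. \<sigma> (Varw i)))
      - hat_rhs (mat n n (\<lambda>(i, j). \<sigma> (VarA i j))) (vec n (\<lambda>i. \<sigma> (Varv i))) (vec n (\<lambda>i. \<sigma> (Varw i)))) k"
proof -
  interpret comm_ring_hom "insertion \<sigma>" by (rule insertion_hom)
  have g: "generic_A n \<in> carrier_mat n n" "generic_v n \<in> carrier_vec n" "generic_w n \<in> carrier_vec n"
    by (simp_all add: generic_A_def generic_v_def generic_w_def)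
  have m: "map_mat (insertion \<sigma>) (generic_A n) = mat n n (\<lambda>(i, j). \<sigma> (VarA i j))"
    "map_vec (insertion \<sigma>) (generic_v n) = vec n (\<lambda>i. \<sigma> (Varv i))"
    "map_vec (insertion \<sigma>) (generic_w n) = vec n (\<lambda>i. \<sigma> (Varw i))"
    by (auto intro!: eq_matI eq_vecI simp: generic_A_def generic_v_def generic_w_def insertion_indet)
  show ?thesis
    unfolding c_hat_def m[symmetric] hom_hat_lhs[OF g, symmetric] hom_hat_rhs[OF g, symmetric]
    by (simp add: coeff_map_poly hom_minus)
qed

lemma c_hat_eval:
  assumes "A \<in> carrier_mat n n" "v \<in> carrier_vec n" "w \<in> carrier_vec n"
  shows "coeff (hat_lhs A v w - hat_rhs A v w) k = eval_at A v w (c_hat n k)"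
proof -
  have m: "mat n n (\<lambda>(i, j). indet_val A v w (VarA i j)) = A" "vec n (\<lambda>i. indet_val A v w (Varv i)) = v"
    "vec n (\<lambda>i. indet_val A v w (Varw i)) = w"
    using assms by (auto intro!: eq_matI eq_vecI)
  show ?thesis unfolding eval_at_eq_insertion insertion_c_hat m ..
qed

text \<open>Every assignment of the indeterminates is a real parameter point, where
  \<open>hat_identity\<close> applies; a real polynomial vanishing at all assignments is
  zero.\<close>

lemma c_hat_zero: "0 < n \<Longrightarrow> c_hat n k = 0"
  by (rule param_poly_eq_zero) (simp add: insertion_c_hat hat_identity)

text \<open>The scaling factor is a product of powers of the three determinants, nonzero on the
  domain, and can be cancelled.\<close>

lemma cleared_eq_on_domain:
  fixes A :: "real mat"
  assumes n: "0 < n" and A: "A \<in> carrier_mat n n" and v: "v \<in> carrier_vec n" and w: "w \<in> carrier_vec n"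
    and nz: "delta_P A * delta_Q A v w * delta_R A v w \<noteq> 0"
  shows "cleared_eq (sol_P A v) (sol_Q A v w) (sol_R A v w)"
proof -
  note sols = sol_solves[OF A v w nz]
  have dimA: "dim_row A = n" using A by simp
  have car: "sol_P A v \<in> carrier_mat n n" "sol_Q A v w \<in> carrier_mat n n" "sol_R A v w \<in> carrier_mat n n"
    using sols by (simp_all add: solves_P_def solves_Q_def solves_R_def dimA)
  note scale = hat_scaling[OF n A car domain_solutions(4-6)[OF A v w nz]]
  have dim: "dim_row (sol_P A v) = n" using car by simp
  have c: "[:(delta_P A * delta_Q A v w) ^ n * ((delta_R A v w)\<^sup>2 * delta_P A * delta_Q A v w ^ n) ^ n:] \<noteq> 0"
    using nz by simp
  show ?thesis
    unfolding cleared_eq_def Let_def dim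
    using hat_identity[OF n A v w] unfolding scale mult_cancel_left using c by blast
qed

section \<open>Invertible Gramians: from the cleared equation to spectra\<close>

lemma inv_mat:
  assumes M: "M \<in> carrier_mat n n" and inv: "invertible_mat M"
  shows "inv_mat M \<in> carrier_mat n n" "M * inv_mat M = 1\<^sub>m n" "inv_mat M * M = 1\<^sub>m n" "det M \<noteq> 0"
proof -
  obtain B where B: "M * B = 1\<^sub>m n" "B * M = 1\<^sub>m (dim_row B)"
    using inv M unfolding invertible_mat_def inverts_mat_def by auto
  \<comment> \<open>\<open>invertible_mat\<close> does not fix the shape of the inverse; comparing
    column counts in the two identities does.\<close>
  have "dim_col B = n" using arg_cong[OF B(1), of dim_col] by simp
  moreover have "dim_row B = n" using arg_cong[OF B(2), of dim_col] M by simp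
  ultimately have Bc: "B \<in> carrier_mat n n" by auto
  \<comment> \<open>Membership in the units rules out the result \<open>None\<close> of
    \<open>mat_inverse\<close>, so \<open>inv_mat\<close> is a true inverse.\<close>
  then have "M \<in> Units (ring_mat TYPE(real) n ())"
    using B M unfolding Units_def ring_mat_def by auto
  then obtain C where C: "mat_inverse M = Some C"
    using mat_inverse(1)[OF M, where b = "()"] by (cases "mat_inverse M") auto
  then show "inv_mat M \<in> carrier_mat n n" "M * inv_mat M = 1\<^sub>m n" "inv_mat M * M = 1\<^sub>m n"
    using mat_inverse(2)[OF M C] by (auto simp: inv_mat_def)
  show "det M \<noteq> 0" using det_mult[OF M Bc] B(1) by auto
qed

lemma char_poly_matrix_const_mat:
  "M \<in> carrier_mat n n \<Longrightarrow> char_poly_matrix M = lam \<cdot>\<^sub>m 1\<^sub>m n - const_mat M"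
  by (rule eq_matI) (auto simp: char_poly_matrix_def const_mat_def)

text \<open>The left pencil factors as det Q * P * (lam - M), the right one as N * (lam - N^-1) with
  N = 1 + P Q. Both sides of the cleared equation thus become a characteristic polynomial times one
  and the same nonzero constant det N * det P * (det Q)^n.\<close>

lemma cleared_eq_iff_char_poly_eq:
  assumes P: "P \<in> carrier_mat n n" and Q: "Q \<in> carrier_mat n n" and R: "R \<in> carrier_mat n n"
    and inv: "invertible_mat P" "invertible_mat Q" "invertible_mat (1\<^sub>m n + P * Q)"
  shows "cleared_eq P Q R \<longleftrightarrow>
    char_poly (inv_mat P * R * inv_mat Q * transpose_mat R) = char_poly (inv_mat (1\<^sub>m n + P * Q))"
proof -
  let ?N = "1\<^sub>m n + P * Q" and ?M = "inv_mat P * R * inv_mat Q * transpose_mat R"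
  have N: "?N \<in> carrier_mat n n" using P Q by simp
  note iP = inv_mat[OF P inv(1)] and iQ = inv_mat[OF Q inv(2)] and iN = inv_mat[OF N inv(3)]
  note adj = adj_mat[OF Q]
  have M: "?M \<in> carrier_mat n n" using iP(1) iQ(1) R by (simp add: sq_carrier[of _ n])
  have "adj_mat Q = adj_mat Q * Q * inv_mat Q"
    using adj(1) Q iQ by (simp add: right_mult_one_mat[of _ n n])
  then have adjQ: "adj_mat Q = det Q \<cdot>\<^sub>m inv_mat Q"
    unfolding adj(3) using iQ(1) by (simp add: mult_smult_assoc_mat[of _ n n _ n] left_mult_one_mat[of _ n n])
  have PM: "P * ?M = R * inv_mat Q * transpose_mat R"
  proof -
    have "P * ?M = P * inv_mat P * R * inv_mat Q * transpose_mat R"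
      using P iP(1) iQ(1) R by (simp add: sq[of _ n])
    then show ?thesis using R by (simp add: iP(2) left_mult_one_mat[OF R])
  qed
  have "([:det Q:] * lam) \<cdot>\<^sub>m const_mat P - const_mat (R * adj_mat Q * transpose_mat R)
      = [:det Q:] \<cdot>\<^sub>m (lam \<cdot>\<^sub>m const_mat P - const_mat (P * ?M))"
    unfolding adjQ PM using P R iQ(1)
    by (subst smult_diff_mat[of _ n n])
       (auto simp: mult_smult_distrib[of _ n n _ n] mult_smult_assoc_mat[of _ n n _ n] const_mat_smult sq_carrier[of _ n])
  also have "lam \<cdot>\<^sub>m const_mat P - const_mat (P * ?M) = const_mat P * char_poly_matrix ?M"
    unfolding char_poly_matrix_const_mat[OF M] const_mat_mult[OF P M] using P M
    by (simp add: mult_minus_distrib_mat[of _ n n _ n] mult_smult_distrib[of _ n n _ n] right_mult_one_mat[of _ n n])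
  finally have 1: "det (([:det Q:] * lam) \<cdot>\<^sub>m const_mat P - const_mat (R * adj_mat Q * transpose_mat R))
      = [:det Q ^ n * det P:] * char_poly ?M"
    using P M char_poly_matrix_closed[OF M] carrier_matD[OF char_poly_matrix_closed[OF M]]
    by (simp add: char_poly_def det_mult[of _ n] det_const_mat poly_const_pow mult.commute)
  have "(lam - 1) \<cdot>\<^sub>m 1\<^sub>m n + lam \<cdot>\<^sub>m const_mat (P * Q) = lam \<cdot>\<^sub>m const_mat ?N - 1\<^sub>m n"
    unfolding const_mat_add[OF one_carrier_mat sq_carrier(1)[OF P Q]] const_mat_one
    using P Q by (intro mat_eqI[of _ n]) (auto simp: sq_carrier[of _ n] algebra_simps)
  also have "\<dots> = const_mat ?N * char_poly_matrix (inv_mat ?N)"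
    unfolding char_poly_matrix_const_mat[OF iN(1)] using N iN(1)
    by (simp add: mult_minus_distrib_mat[of _ n n _ n] mult_smult_distrib[of _ n n _ n] right_mult_one_mat[of _ n n]
        const_mat_mult[OF N iN(1), symmetric] iN(2) const_mat_one)
  finally have 2: "det ((lam - 1) \<cdot>\<^sub>m 1\<^sub>m n + lam \<cdot>\<^sub>m const_mat (P * Q)) = [:det ?N:] * char_poly (inv_mat ?N)"
    using N iN(1) char_poly_matrix_closed[OF iN(1)]
    by (simp add: char_poly_def det_mult[of _ n] det_const_mat)
  have dim: "dim_row P = n" using P by simp
  have c: "[:det ?N * det P * det Q ^ n:] \<noteq> 0" using iP(4) iQ(4) iN(4) by simp
  have "cleared_eq P Q R \<longleftrightarrow>
      [:det ?N * det P * det Q ^ n:] * char_poly ?M = [:det ?N * det P * det Q ^ n:] * char_poly (inv_mat ?N)"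
    unfolding cleared_eq_def Let_def dim 1 2 by (simp add: mult_ac)
  also have "\<dots> \<longleftrightarrow> char_poly ?M = char_poly (inv_mat ?N)"
    unfolding mult_cancel_left using c by blast
  finally show ?thesis .
qed

lemma char_poly_eq_imp_spectrum_eq:
  assumes "M \<in> carrier_mat n n" "K \<in> carrier_mat n n" "char_poly M = char_poly K"
  shows "spectrum_mset M = spectrum_mset K"
  unfolding spectrum_mset_def of_real_hom.char_poly_hom[OF assms(1)] of_real_hom.char_poly_hom[OF assms(2)]
    assms(3) ..

text \<open>The first block ensures that the \<open>THE\<close> terms denote actual solutions with
  the hats as their numerators. The clause on \<open>eval_at\<close> certifies that the formal
  \<open>c_hat\<close> are the coefficients of the real identity.\<close>

theorem lemma18:
  fixes n :: nat
  assumes "n \<ge> 1"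
  shows
    "(\<forall>(A, v, w) \<in> param_domain n.
        (\<exists>!X. solves_P A v X) \<and> (\<exists>!X. solves_Q A v w X) \<and> (\<exists>!X. solves_R A v w X) \<and>
        P_hat A v = delta_P A \<cdot>\<^sub>m sol_P A v \<and>
        Q_hat A v w = delta_Q A v w \<cdot>\<^sub>m sol_Q A v w \<and>
        R_hat A v w = delta_R A v w \<cdot>\<^sub>m sol_R A v w)
     \<and>
     (\<forall>(A, v, w) \<in> param_domain n.
        let P = sol_P A v; Q = sol_Q A v w; R = sol_R A v w;
            M = inv_mat P * R * inv_mat Q * transpose_mat R;
            K = inv_mat (1\<^sub>m n + P * Q)
        in invertible_mat P \<and> invertible_mat Q \<and> invertible_mat (1\<^sub>m n + P * Q) \<longrightarrow>
             (cleared_eq P Q R \<longleftrightarrow> char_poly M = char_poly K) \<and>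
             (cleared_eq P Q R \<longleftrightarrow> spectrum_mset M = spectrum_mset K))
     \<and>
     ((\<forall>A v w. A \<in> carrier_mat n n \<longrightarrow> v \<in> carrier_vec n \<longrightarrow> w \<in> carrier_vec n \<longrightarrow>
         (\<forall>k. coeff (hat_lhs A v w - hat_rhs A v w) k = eval_at A v w (c_hat n k))) \<and>
      (\<forall>k. c_hat n k = 0) \<and>
      (\<forall>A v w. A \<in> carrier_mat n n \<longrightarrow> v \<in> carrier_vec n \<longrightarrow> w \<in> carrier_vec n \<longrightarrow>
         (hat_lhs A v w :: real poly) = hat_rhs A v w) \<and>
      (\<forall>(A, v, w) \<in> param_domain n. cleared_eq (sol_P A v) (sol_Q A v w) (sol_R A v w)))
     \<and>
     (\<forall>(A, v, w) \<in> param_domain n.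
        let P = sol_P A v; Q = sol_Q A v w; R = sol_R A v w
        in invertible_mat P \<and> invertible_mat Q \<and> invertible_mat (1\<^sub>m n + P * Q) \<longrightarrow>
             spectrum_mset (inv_mat P * R * inv_mat Q * transpose_mat R)
             = spectrum_mset (inv_mat (1\<^sub>m n + P * Q)))"
proof -
  have n: "0 < n" using assms by simp
  have solutions: "(\<exists>!X. solves_P A v X) \<and> (\<exists>!X. solves_Q A v w X) \<and> (\<exists>!X. solves_R A v w X) \<and>
        P_hat A v = delta_P A \<cdot>\<^sub>m sol_P A v \<and>
        Q_hat A v w = delta_Q A v w \<cdot>\<^sub>m sol_Q A v w \<and>
        R_hat A v w = delta_R A v w \<cdot>\<^sub>m sol_R A v w"
    if "(A, v, w) \<in> param_domain n" for A v w
    using that domain_solutions[of A n v w] by (auto simp: param_domain_def)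
  have cleared: "cleared_eq (sol_P A v) (sol_Q A v w) (sol_R A v w)"
    if "(A, v, w) \<in> param_domain n" for A v w
    using that cleared_eq_on_domain[OF n, of A v w] by (auto simp: param_domain_def)
  have equivalences:
    "cleared_eq (sol_P A v) (sol_Q A v w) (sol_R A v w) \<longleftrightarrow>
      char_poly (inv_mat (sol_P A v) * sol_R A v w * inv_mat (sol_Q A v w) * transpose_mat (sol_R A v w))
      = char_poly (inv_mat (1\<^sub>m n + sol_P A v * sol_Q A v w))" (is ?char)
    "spectrum_mset (inv_mat (sol_P A v) * sol_R A v w * inv_mat (sol_Q A v w) * transpose_mat (sol_R A v w))
      = spectrum_mset (inv_mat (1\<^sub>m n + sol_P A v * sol_Q A v w))" (is ?spec)
    if dom: "(A, v, w) \<in> param_domain n"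
      and inv: "invertible_mat (sol_P A v)" "invertible_mat (sol_Q A v w)"
        "invertible_mat (1\<^sub>m n + sol_P A v * sol_Q A v w)" for A v w
  proof -
    from dom have A: "A \<in> carrier_mat n n" "v \<in> carrier_vec n" "w \<in> carrier_vec n"
      and nz: "delta_P A * delta_Q A v w * delta_R A v w \<noteq> 0" by (auto simp: param_domain_def)
    have car: "sol_P A v \<in> carrier_mat n n" "sol_Q A v w \<in> carrier_mat n n" "sol_R A v w \<in> carrier_mat n n"
      using sol_solves[OF A nz] A(1) by (auto simp: solves_P_def solves_Q_def solves_R_def)
    have N: "1\<^sub>m n + sol_P A v * sol_Q A v w \<in> carrier_mat n n" using car by simp
    show ?char by (rule cleared_eq_iff_char_poly_eq[OF car inv])
    then show ?spec
      using cleared[OF dom] inv_mat(1)[OF car(1) inv(1)] inv_mat(1)[OF car(2) inv(2)] inv_mat(1)[OF N inv(3)] car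
      by (intro char_poly_eq_imp_spectrum_eq[of _ n]) (auto simp: sq_carrier[of _ n])
  qed
  show ?thesis
  proof (intro conjI, goal_cases)
    case 1
    show ?case by (simp add: Ball_def split_paired_All solutions)
  next
    case 2
    \<comment> \<open>The equivalence with characteristic polynomials comes from the factored
      pencils. For spectra, both sides of the equivalence hold on the domain.\<close>
    show ?case by (simp add: Ball_def split_paired_All Let_def equivalences(1)[symmetric] equivalences(2) cleared)
  next
    case 3
    show ?case using c_hat_eval by blast
  next
    case 4
    show ?case by (simp add: c_hat_zero[OF n])
  next
    case 5
    show ?case using hat_identity[OF n] by blast
  next
    case 6
    show ?case by (simp add: Ball_def split_paired_All cleared)
  next
    case 7
    show ?case by (simp add: Ball_def split_paired_All Let_def equivalences(2))
  qed
qed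

end
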